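(* Let $G$ be a $d$-regular Ramanujan graph on $n$ nodes with $d\ge 3$. Then for every node $s$ of $G$, for at least $(1-o(1))n$ nodes $t$ of $G$ (as $n\to\infty$) it holds that bidirectional BFS between $s$ and $t$ finds a shortest $s$-$t$ path after visiting $O(\sqrt n\cdot \ln^{3/2}(n))$ nodes.
   Context: A $d$-regular $n$-node graph is Ramanujan if the eigenvalues $\lambda_1\ge\cdots\ge\lambda_n$ of its adjacency matrix satisfy $\max_{i\neq 1}|\lambda_i|\le 2\sqrt{d-1}$. Bidirectional BFS between $s$ and $t$: simultaneously grow a BFS tree from $s$ and a BFS tree from $t$, in each iteration computing the next layer of both trees; as soon as some node $v$ appears in both trees, output the path $s\to v\to t$ formed by the tree paths. *)

theory Defs
  imports
    Complex_Main
    "HOL-Library.Landau_Symbols"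
    "Jordan_Normal_Form.Char_Poly"
    "Graph_Theory.Graph_Theory"
begin

section \<open>Ramanujan graphs\<close>

text \<open>An \<open>n\<close>-node graph is a finite simple graph (symmetric, without loops or parallel arcs) on
  the node set \<open>{..<n}\<close>.\<close>

definition adjacency_matrix :: "nat \<Rightarrow> nat pair_pre_digraph \<Rightarrow> real mat" where
  "adjacency_matrix n G = mat n n (\<lambda>(i, j). if (i, j) \<in> parcs G then 1 else 0)"

text \<open>The eigenvalues with multiplicity, in descending order. The list is indexed from
  \<open>0\<close>, so that \<open>\<lambda>\<^sub>1\<close> is its element \<open>0\<close>. No eigenvalue is lost by taking real roots only, see
  \<open>length_graph_eigenvalues\<close>.\<close>

definition graph_eigenvalues :: "nat \<Rightarrow> nat pair_pre_digraph \<Rightarrow> real list" where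
  "graph_eigenvalues n G =
     rev (sorted_list_of_multiset (proots (char_poly (adjacency_matrix n G))))"

lemma length_graph_eigenvalues:
  assumes "pair_graph G"
  shows "length (graph_eigenvalues n G) = n"
proof -
  interpret pair_graph G by fact
  define A where "A = adjacency_matrix n G"
  define C where "C = map_mat complex_of_real A"
  have A: "A \<in> carrier_mat n n" by (simp add: A_def adjacency_matrix_def)
  have C: "C \<in> carrier_mat n n" using A by (simp add: C_def)
  have psym: "(i, j) \<in> parcs G \<longleftrightarrow> (j, i) \<in> parcs G" for i j
    using sym_arcs by (auto simp: symmetric_def sym_def)
  have symA: "A $$ (i, j) = A $$ (j, i)" if "i < n" "j < n" for i j
    using that psym[of i j] by (simp add: A_def adjacency_matrix_def)
  have entry: "C $$ (i, j) = complex_of_real (A $$ (i, j))" if "i < n" "j < n" for i j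
    using that A by (simp add: C_def)
  obtain as where as: "char_poly C = (\<Prod>a\<leftarrow>as. [:- a, 1:])" "length as = n"
    using char_poly_factorized[OF C] by blast
  have real: "Im a = 0" if "a \<in> set as" for a
  proof -
    have "poly (char_poly C) a = 0" using that
      unfolding as poly_prod_list by (force simp: prod_list_zero_iff)
    then obtain v where v: "v \<in> carrier_vec n" "v \<noteq> 0\<^sub>v n" "C *\<^sub>v v = a \<cdot>\<^sub>v v"
      using eigenvalue_root_char_poly[OF C] C by (auto simp: eigenvalue_def eigenvector_def)
    have row: "(\<Sum>j<n. C $$ (i, j) * v $ j) = a * v $ i" if "i < n" for i
    proof -
      have "(C *\<^sub>v v) $ i = (\<Sum>j<n. C $$ (i, j) * v $ j)"
        using that C v(1) by (simp add: scalar_prod_def lessThan_atLeast0)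
      then show ?thesis using that v by simp
    qed
    define N where "N = (\<Sum>i<n. cnj (v $ i) * v $ i)"
    have "a * N = (\<Sum>i<n. cnj (v $ i) * (a * v $ i))"
      by (simp add: N_def sum_distrib_left mult_ac)
    also have "\<dots> = (\<Sum>i<n. cnj (v $ i) * (\<Sum>j<n. C $$ (i, j) * v $ j))"
      by (intro sum.cong refl) (simp add: row)
    also have "\<dots> = (\<Sum>i<n. \<Sum>j<n. C $$ (i, j) * cnj (v $ i) * v $ j)"
      by (simp add: sum_distrib_left mult_ac)
    finally have 1: "a * N = \<dots>" .
    have "cnj (a * N) = (\<Sum>i<n. \<Sum>j<n. C $$ (i, j) * v $ i * cnj (v $ j))"
      unfolding 1 by (simp add: entry)
    also have "\<dots> = (\<Sum>j<n. \<Sum>i<n. C $$ (i, j) * v $ i * cnj (v $ j))" by (rule sum.swap)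
    also have "\<dots> = a * N" unfolding 1
      by (intro sum.cong refl) (simp add: entry symA mult_ac)
    finally have 2: "cnj (a * N) = a * N" .
    have N: "N = complex_of_real (\<Sum>i<n. (cmod (v $ i))\<^sup>2)"
      unfolding N_def of_real_sum
      by (intro sum.cong refl) (simp only: complex_norm_square mult.commute)
    have "N \<noteq> 0"
    proof
      assume "N = 0"
      then have "(\<Sum>i<n. (cmod (v $ i))\<^sup>2) = 0" unfolding N of_real_eq_0_iff .
      then have "\<forall>i<n. v $ i = 0" by (simp add: sum_nonneg_eq_0_iff)
      then have "v = 0\<^sub>v n" using v(1) by (intro eq_vecI) auto
      with v show False by simp
    qed
    moreover have "cnj N = N" unfolding N by (rule complex_cnj_complex_of_real)
    ultimately have "cnj a = a" using 2 by simp
    then show ?thesis by (simp add: complex_eq_iff)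
  qed
  define rs where "rs = map Re as"
  have as_rs: "as = map complex_of_real rs"
    unfolding rs_def using real by (auto simp: complex_eq_iff intro!: nth_equalityI)
  interpret h: map_poly_inj_idom_hom complex_of_real by unfold_locales
  have "map_poly complex_of_real (char_poly A) = char_poly C"
    unfolding C_def by (rule of_real_hom.char_poly_hom[OF A, symmetric])
  also have "\<dots> = map_poly complex_of_real (\<Prod>a\<leftarrow>rs. [:- a, 1:])"
    unfolding as as_rs by (simp add: h.hom_prod_list o_def)
  finally have "char_poly A = (\<Prod>a\<leftarrow>rs. [:- a, 1:])" by simp
  moreover have "proots (\<Prod>a\<leftarrow>rs. [:- a, 1:]) = mset rs"
  proof (induction rs)
    case (Cons a rs)
    have "(\<Prod>a\<leftarrow>rs. [:- a, 1:]) \<noteq> 0" by (auto simp: prod_list_zero_iff)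
    then have "proots ([:- a, 1:] * (\<Prod>a\<leftarrow>rs. [:- a, 1:])) = {#a#} + mset rs"
      using Cons.IH by (subst proots_mult) auto
    then show ?case by simp
  qed simp
  moreover have "length rs = n" using as by (simp add: rs_def)
  ultimately show ?thesis unfolding graph_eigenvalues_def A_def[symmetric]
    by (metis length_rev mset_sorted_list_of_multiset size_mset)
qed

definition ramanujan_graph :: "nat \<Rightarrow> nat \<Rightarrow> nat pair_pre_digraph \<Rightarrow> bool" where
  "ramanujan_graph n d G \<longleftrightarrow>
     pair_graph G \<and> pverts G = {..<n} \<and>
     (\<forall>v\<in>pverts G. out_degree (with_proj G) v = d) \<and>
     (\<forall>i. i < n \<and> i \<noteq> 0 \<longrightarrow> \<bar>graph_eigenvalues n G ! i\<bar> \<le> 2 * sqrt (real d - 1))"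


section \<open>Bidirectional BFS\<close>

definition shortest_path :: "'a pair_pre_digraph \<Rightarrow> 'a \<Rightarrow> 'a \<Rightarrow> 'a list \<Rightarrow> bool" where
  "shortest_path G s t p \<longleftrightarrow>
     vpath p (with_proj G) \<and> hd p = s \<and> last p = t \<and>
     (\<forall>q. vpath q (with_proj G) \<and> hd q = s \<and> last q = t \<longrightarrow> vwalk_length p \<le> vwalk_length q)"

text \<open>A partially grown BFS tree: the nodes visited so far, the last completed layer, the part of
  the next layer discovered so far, and for every visited node its tree path from the root. The
  parent of a node is the last but one node of its tree path. Values of \<open>root_path\<close> outside of
  \<open>visited\<close> carry no meaning.\<close>

record 'a bfs_tree =
  visited :: "'a set"
  layer :: "'a set"
  next_layer :: "'a set"
  root_path :: "'a \<Rightarrow> 'a list"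

definition bfs_root :: "'a \<Rightarrow> 'a bfs_tree" where
  "bfs_root r = \<lparr>visited = {r}, layer = {r}, next_layer = {}, root_path = (\<lambda>_. [r])\<rparr>"

inductive bfs_discover :: "'a pair_pre_digraph \<Rightarrow> 'a bfs_tree \<Rightarrow> 'a bfs_tree \<Rightarrow> bool" for G T where
  "\<lbrakk>u \<in> layer T; (u, w) \<in> parcs G; w \<notin> visited T\<rbrakk> \<Longrightarrow>
   bfs_discover G T
     (T\<lparr>visited := insert w (visited T),
        next_layer := insert w (next_layer T),
        root_path := (root_path T)(w := root_path T u @ [w])\<rparr>)"

definition next_layer_complete :: "'a pair_pre_digraph \<Rightarrow> 'a bfs_tree \<Rightarrow> bool" where
  "next_layer_complete G T \<longleftrightarrow> (\<forall>u\<in>layer T. \<forall>w. (u, w) \<in> parcs G \<longrightarrow> w \<in> visited T)"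

definition advance_layer :: "'a bfs_tree \<Rightarrow> 'a bfs_tree" where
  "advance_layer T = T\<lparr>layer := next_layer T, next_layer := {}\<rparr>"

text \<open>A state records which tree is being grown, the tree of \<open>s\<close> and the tree of \<open>t\<close>. One
  iteration computes the next layer of the tree of \<open>s\<close> and then that of the tree of \<open>t\<close>. The
  common-node test takes place after every single discovery, also within a layer. The order in which
  a layer is discovered and the choice among several possible parents are left open. On a pair of
  nodes in different components there is no common node, and the search runs forever.\<close>

datatype turn = Grow_s | Grow_t

type_synonym 'a bibfs_state = "turn \<times> 'a bfs_tree \<times> 'a bfs_tree"

inductive bibfs_step :: "'a pair_pre_digraph \<Rightarrow> 'a bibfs_state \<Rightarrow> 'a bibfs_state \<Rightarrow> bool" for G where
  "\<lbrakk>visited S \<inter> visited T = {}; bfs_discover G S S'\<rbrakk> \<Longrightarrow>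
   bibfs_step G (Grow_s, S, T) (Grow_s, S', T)"
| "\<lbrakk>visited S \<inter> visited T = {}; next_layer_complete G S\<rbrakk> \<Longrightarrow>
   bibfs_step G (Grow_s, S, T) (Grow_t, advance_layer S, T)"
| "\<lbrakk>visited S \<inter> visited T = {}; bfs_discover G T T'\<rbrakk> \<Longrightarrow>
   bibfs_step G (Grow_t, S, T) (Grow_t, S, T')"
| "\<lbrakk>visited S \<inter> visited T = {}; next_layer_complete G T\<rbrakk> \<Longrightarrow>
   bibfs_step G (Grow_t, S, T) (Grow_s, S, advance_layer T)"

definition bibfs_start :: "'a \<Rightarrow> 'a \<Rightarrow> 'a bibfs_state" where
  "bibfs_start s t = (Grow_s, bfs_root s, bfs_root t)"

definition bibfs_terminates :: "'a pair_pre_digraph \<Rightarrow> 'a \<Rightarrow> 'a \<Rightarrow> bool" where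
  "bibfs_terminates G s t \<longleftrightarrow>
     \<not> (\<exists>\<sigma>. \<sigma> 0 = bibfs_start s t \<and> (\<forall>i::nat. bibfs_step G (\<sigma> i) (\<sigma> (Suc i))))"

definition bibfs_result ::
    "'a pair_pre_digraph \<Rightarrow> 'a \<Rightarrow> 'a \<Rightarrow> 'a bfs_tree \<Rightarrow> 'a bfs_tree \<Rightarrow> bool" where
  "bibfs_result G s t S T \<longleftrightarrow>
     (\<exists>c. (bibfs_step G)\<^sup>*\<^sup>* (bibfs_start s t) (c, S, T) \<and> \<not> (\<exists>\<sigma>. bibfs_step G (c, S, T) \<sigma>))"

text \<open>Every run ends with a common node, every common node \<open>v\<close> yields a shortest path
  \<open>s \<rightarrow> v \<rightarrow> t\<close>, and at most \<open>b\<close> nodes are visited. Nodes in both trees count twice.\<close>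

definition bibfs_finds_shortest_path ::
    "'a pair_pre_digraph \<Rightarrow> 'a \<Rightarrow> 'a \<Rightarrow> real \<Rightarrow> bool" where
  "bibfs_finds_shortest_path G s t b \<longleftrightarrow>
     bibfs_terminates G s t \<and>
     (\<forall>S T. bibfs_result G s t S T \<longrightarrow>
        visited S \<inter> visited T \<noteq> {} \<and>
        (\<forall>v \<in> visited S \<inter> visited T.
           shortest_path G s t (vwalk_join (root_path S v) (rev (root_path T v)))) \<and>
        real (card (visited S) + card (visited T)) \<le> b)"

end

theory Submission
  imports Defs "Jordan_Normal_Form.Schur_Decomposition" "HOL-Analysis.L2_Norm"
begin

text \<open>Let \<open>A\<close> be the adjacency matrix and \<open>q = d - 1\<close>. Comparing \<open>tr A\<^sup>2\<^sup>m = \<Sum>\<lambda>\<^sub>i\<^sup>2\<^sup>m\<close> with the Frobenius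
  norm shows that \<open>A / sqrt q\<close> has norm at most \<open>2\<close> on the vectors orthogonal to the constants. The
  Chebyshev polynomial \<open>U\<^sub>k(A / (2 sqrt q))\<close> then has norm at most \<open>k + 1\<close> there, while it multiplies
  constants by at least \<open>q powr (k / 2)\<close>. Applied to the indicator of \<open>s\<close>, a polynomial of degree \<open>k\<close>
  in \<open>A\<close> vanishes at all nodes at distance more than \<open>k\<close>, so there are at most
  \<open>n\<^sup>2 (k + 1)\<^sup>2 / q ^ k\<close> such nodes. For the least \<open>k\<close> with \<open>q ^ k \<ge> n (ln n)\<^sup>3\<close> this is \<open>o(n)\<close>.

  For the other nodes \<open>t\<close>, disjoint trees of depths \<open>a\<close> and \<open>b\<close> witness \<open>a + b < dist s t\<close>. So every
  common node lies on a shortest path, and both trees stay inside balls of radius \<open>\<lceil>k / 2\<rceil>\<close>, which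
  have \<open>O(q powr (k / 2)) = O(sqrt n (ln n) powr (3 / 2))\<close> nodes.\<close>

section \<open>Power sums of eigenvalues\<close>

lemma index_mult_mat_sum:
  assumes "A \<in> carrier_mat n m" and "B \<in> carrier_mat m p" and "i < n" and "j < p"
  shows "(A * B) $$ (i, j) = (\<Sum>l<m. A $$ (i, l) * B $$ (l, j))"
  using assms by (auto simp: scalar_prod_def lessThan_atLeast0)

lemma sum_diag_mult_commute:
  fixes P Q :: "'a :: comm_semiring_0 mat"
  assumes P: "P \<in> carrier_mat n m" and Q: "Q \<in> carrier_mat m n"
  shows "(\<Sum>i<n. (P * Q) $$ (i, i)) = (\<Sum>i<m. (Q * P) $$ (i, i))"
proof -
  have "(\<Sum>i<n. (P * Q) $$ (i, i)) = (\<Sum>i<n. \<Sum>j<m. P $$ (i, j) * Q $$ (j, i))"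
    by (intro sum.cong refl index_mult_mat_sum[OF P Q]) auto
  also have "\<dots> = (\<Sum>j<m. \<Sum>i<n. Q $$ (j, i) * P $$ (i, j))"
    by (subst sum.swap) (simp add: mult.commute)
  also have "\<dots> = (\<Sum>i<m. (Q * P) $$ (i, i))"
    by (intro sum.cong refl index_mult_mat_sum[OF Q P, symmetric]) auto
  finally show ?thesis .
qed

lemma upper_triangular_pow:
  fixes B :: "'a :: comm_semiring_1 mat"
  assumes B: "B \<in> carrier_mat n n" and ut: "upper_triangular B"
  shows "upper_triangular (B ^\<^sub>m k) \<and> (\<forall>i<n. (B ^\<^sub>m k) $$ (i, i) = B $$ (i, i) ^ k)"
proof (induction k)
  case 0
  show ?case using B by (auto intro!: upper_triangularI)
next
  case (Suc k)
  have C: "B ^\<^sub>m k \<in> carrier_mat n n" using B by simp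
  have low: "B $$ (i, j) = 0" "(B ^\<^sub>m k) $$ (i, j) = 0" if "j < i" "i < n" for i j
    using that ut Suc B C by (auto dest: upper_triangularD)
  have entry: "(B ^\<^sub>m Suc k) $$ (i, j) = (\<Sum>l<n. (B ^\<^sub>m k) $$ (i, l) * B $$ (l, j))"
    if "i < n" "j < n" for i j
    using index_mult_mat_sum[OF C B that] by simp
  have "(B ^\<^sub>m Suc k) $$ (i, j) = 0" if "j < i" "i < n" for i j
  proof -
    have "(B ^\<^sub>m k) $$ (i, l) * B $$ (l, j) = 0" if "l < n" for l
      using \<open>j < i\<close> \<open>i < n\<close> that low(1)[of j l] low(2)[of l i] by (cases "l < i") auto
    then show ?thesis using that by (simp del: pow_mat.simps add: entry)
  qed
  moreover have "(B ^\<^sub>m Suc k) $$ (i, i) = B $$ (i, i) ^ Suc k" if "i < n" for i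
  proof -
    have "(B ^\<^sub>m k) $$ (i, l) * B $$ (l, i) = 0" if "l < n" "l \<noteq> i" for l
      using \<open>i < n\<close> that low(1)[of i l] low(2)[of l i] by (cases "l < i") auto
    then have "(\<Sum>l<n. (B ^\<^sub>m k) $$ (i, l) * B $$ (l, i)) = (B ^\<^sub>m k) $$ (i, i) * B $$ (i, i)"
      using that by (subst sum.remove[of _ i]) auto
    then show ?thesis using that Suc by (simp del: pow_mat.simps add: entry mult.commute)
  qed
  ultimately show ?case using B by (auto intro!: upper_triangularI simp del: pow_mat.simps)
qed

text \<open>Schur triangularisation conjugates \<open>A\<close> to an upper triangular
  \<open>B\<close> with diagonal \<open>es\<close>. Conjugation passes through powers, and the trace
  does not see it.\<close>

lemma sum_diag_pow_mat:
  fixes A :: "'a :: conjugatable_ordered_field mat"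
  assumes A: "A \<in> carrier_mat n n" and es: "char_poly A = (\<Prod>a\<leftarrow>es. [:- a, 1:])"
  shows "(\<Sum>i<n. (A ^\<^sub>m k) $$ (i, i)) = (\<Sum>a\<leftarrow>es. a ^ k)"
proof -
  obtain B P Q where "schur_decomposition A es = (B, P, Q)" by (metis prod_cases3)
  from schur_decomposition[OF A es this]
  have wit: "similar_mat_wit A B P Q" and ut: "upper_triangular B" and diag: "diag_mat B = es"
    by auto
  from similar_mat_witD2[OF A wit] have car: "B \<in> carrier_mat n n" "P \<in> carrier_mat n n"
    "Q \<in> carrier_mat n n" and QP: "Q * P = 1\<^sub>m n" by auto
  have Bk: "B ^\<^sub>m k \<in> carrier_mat n n" using car by simp
  have "(\<Sum>i<n. (A ^\<^sub>m k) $$ (i, i)) = (\<Sum>i<n. (P * (B ^\<^sub>m k * Q)) $$ (i, i))"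
    unfolding similar_mat_wit_pow_id[OF wit] using car Bk by (simp add: assoc_mult_mat[of _ n n _ n _ n])
  also have "\<dots> = (\<Sum>i<n. (B ^\<^sub>m k * Q * P) $$ (i, i))"
    using car Bk by (intro sum_diag_mult_commute) auto
  also have "B ^\<^sub>m k * Q * P = B ^\<^sub>m k"
    using car Bk QP by (simp add: assoc_mult_mat[of _ n n _ n _ n])
  also have "(\<Sum>i<n. (B ^\<^sub>m k) $$ (i, i)) = (\<Sum>i<n. B $$ (i, i) ^ k)"
    using upper_triangular_pow[OF car(1) ut, of k] by simp
  also have "\<dots> = (\<Sum>a\<leftarrow>es. a ^ k)"
    using car by (simp add: diag[symmetric] diag_mat_def o_def interv_sum_list_conv_sum_set_nat lessThan_atLeast0)
  finally show ?thesis .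
qed

text \<open>Turns a count of roots into a factorization: each root splits off a linear factor,
  lowering degree and root count together, until the constant 1 is left.\<close>

lemma monic_eq_prod_proots:
  fixes p :: "'a :: idom poly"
  assumes "monic p" and "size (proots p) = degree p"
  shows "p = (\<Prod>a\<in>#proots p. [:- a, 1:])"
  using assms
proof (induction "degree p" arbitrary: p)
  case 0
  then show ?case by (auto elim!: degree_eq_zeroE)
next
  case (Suc m)
  then obtain a where "a \<in># proots p" by (metis multiset_nonemptyE nat.distinct(1) size_empty)
  moreover have "p \<noteq> 0" using Suc by auto
  ultimately have "poly p a = 0" by simp
  then obtain r where r: "p = [:- a, 1:] * r" by (metis poly_eq_0_iff_dvd dvdE)
  with \<open>p \<noteq> 0\<close> have "r \<noteq> 0" by auto
  then have pr: "proots p = add_mset a (proots r)" "degree p = Suc (degree r)"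
    unfolding r by (simp_all add: proots_mult degree_mult_eq del: mult_pCons_left)
  have "lead_coeff p = lead_coeff r" unfolding r by (subst lead_coeff_mult) simp
  with Suc pr have "r = (\<Prod>a\<in>#proots r. [:- a, 1:])" by auto
  then show ?case unfolding pr by (metis r image_mset_add_mset prod_mset.add_mset)
qed

section \<open>The spectral gap as an operator norm bound\<close>

text \<open>Vectors are functions on all of \<open>nat\<close>. Only entries below \<open>n\<close>
  are read, so vectors that agree there have images equal at every index.\<close>

definition mat_app :: "nat \<Rightarrow> (nat \<Rightarrow> nat \<Rightarrow> real) \<Rightarrow> (nat \<Rightarrow> real) \<Rightarrow> nat \<Rightarrow> real" where
  "mat_app n a x i = (\<Sum>j<n. a i j * x j)"

lemma mat_app_self_adjoint:
  assumes "\<And>i j. i < n \<Longrightarrow> j < n \<Longrightarrow> a i j = a j i"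
  shows "(\<Sum>i<n. mat_app n a x i * y i) = (\<Sum>i<n. x i * mat_app n a y i)"
proof -
  have "(\<Sum>i<n. mat_app n a x i * y i) = (\<Sum>i<n. \<Sum>j<n. a i j * x j * y i)"
    by (simp add: mat_app_def sum_distrib_right)
  also have "\<dots> = (\<Sum>j<n. \<Sum>i<n. a j i * x j * y i)"
    by (subst sum.swap) (intro sum.cong refl, simp add: assms)
  also have "\<dots> = (\<Sum>i<n. x i * mat_app n a y i)"
    by (simp add: mat_app_def sum_distrib_left mult_ac)
  finally show ?thesis .
qed

lemma L2_set_squared: "(L2_set x A)\<^sup>2 = (\<Sum>i\<in>A. (x i)\<^sup>2)"
  by (simp add: L2_set_def sum_nonneg)

lemma sum_mult_le_L2_set: "(\<Sum>i\<in>A. x i * y i) \<le> L2_set x A * L2_set y A"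
  by (rule order_trans[OF _ L2_set_mult_ineq]) (auto intro!: sum_mono simp: abs_mult[symmetric])

text \<open>By self-adjointness \<open>|a\<^sup>mx|\<close> is log-convex in \<open>m\<close>, so its first ratio is at most its growth rate.\<close>

lemma mat_app_le_growth_rate:
  assumes sym: "\<And>i j. i < n \<Longrightarrow> j < n \<Longrightarrow> a i j = a j i"
    and bound: "\<And>m. L2_set ((mat_app n a ^^ m) x) {..<n} \<le> C * r ^ m" and "r > 0"
  shows "L2_set (mat_app n a x) {..<n} \<le> r * L2_set x {..<n}"
proof (rule ccontr)
  define N where "N m = L2_set ((mat_app n a ^^ m) x) {..<n}" for m
  assume "\<not> ?thesis"
  then have less: "r * N 0 < N 1" by (simp add: N_def)
  have nonneg: "N m \<ge> 0" for m by (simp add: N_def L2_set_nonneg)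
  have convex: "(N (Suc m))\<^sup>2 \<le> N m * N (Suc (Suc m))" for m
  proof -
    have "(N (Suc m))\<^sup>2 = (\<Sum>i<n. mat_app n a ((mat_app n a ^^ m) x) i * (mat_app n a ^^ Suc m) x i)"
      unfolding N_def L2_set_squared by (simp add: power2_eq_square)
    also have "\<dots> = (\<Sum>i<n. (mat_app n a ^^ m) x i * (mat_app n a ^^ Suc (Suc m)) x i)"
      by (subst mat_app_self_adjoint[OF sym]) simp_all
    also have "\<dots> \<le> N m * N (Suc (Suc m))" unfolding N_def by (rule sum_mult_le_L2_set)
    finally show ?thesis .
  qed
  have pos: "N 0 > 0"
  proof (rule ccontr)
    assume "\<not> N 0 > 0"
    with nonneg[of 0] have "N 0 = 0" by linarith
    then have "\<forall>i<n. x i = 0" by (simp add: N_def L2_set_eq_0_iff)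
    then have "N 1 = 0" by (simp add: N_def mat_app_def L2_set_eq_0_iff)
    with less \<open>\<not> N 0 > 0\<close> nonneg[of 0] show False by simp
  qed
  define b where "b = N 1 / N 0"
  have b: "b > r" using less pos by (simp add: b_def field_simps)
  \<comment> \<open>Cancelling \<open>N m\<close> in the convexity inequality passes the ratio bound
    on to the next index, so positivity has to be carried along.\<close>
  have step: "N m > 0 \<and> N (Suc m) \<ge> b * N m" for m
  proof (induction m)
    case (Suc m)
    have "N (Suc m) > 0" using Suc b \<open>r > 0\<close> by (smt (verit) mult_pos_pos)
    have "b * N (Suc m) * N m \<le> (N (Suc m))\<^sup>2"
      using Suc \<open>N (Suc m) > 0\<close> by (simp add: power2_eq_square algebra_simps)
    also have "\<dots> \<le> N (Suc (Suc m)) * N m" using convex[of m] by (simp add: mult.commute)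
    finally show ?case using Suc \<open>N (Suc m) > 0\<close> by simp
  qed (use pos in \<open>simp add: b_def\<close>)
  have grow: "N m \<ge> b ^ m * N 0" for m
  proof (induction m)
    case (Suc m)
    have "b ^ Suc m * N 0 \<le> b * N m" using Suc b \<open>r > 0\<close> by simp
    with step[of m] show ?case by linarith
  qed simp
  have "(b / r) ^ m \<le> C / N 0" for m
  proof -
    have "b ^ m * N 0 \<le> C * r ^ m" using grow[of m] bound[of m] by (simp add: N_def)
    then show ?thesis using pos \<open>r > 0\<close> by (simp add: power_divide field_simps)
  qed
  moreover obtain m where "C / N 0 < (b / r) ^ m"
    using real_arch_pow[of "b / r" "C / N 0"] b \<open>r > 0\<close> by auto
  ultimately show False by (meson not_le)
qed

text \<open>The recurrence is that of the Chebyshev polynomials of the second kind. It conserves the energy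
  \<open>|u (k + 1)|\<^sup>2 + |u k|\<^sup>2 - \<langle>a (u k), u (k + 1)\<rangle> = |u (k + 1) - a (u k) / 2|\<^sup>2 + |u k|\<^sup>2 - |a (u k)|\<^sup>2 / 4\<close>.\<close>

lemma chebyshev_recurrence_bound:
  assumes sym: "\<And>i j. i < n \<Longrightarrow> j < n \<Longrightarrow> a i j = a j i"
    and bound: "\<And>k. L2_set (mat_app n a (u k)) {..<n} \<le> 2 * L2_set (u k) {..<n}"
    and u1: "u 1 = mat_app n a (u 0)"
    and rec: "\<And>k. u (Suc (Suc k)) = (\<lambda>i. mat_app n a (u (Suc k)) i - u k i)"
  shows "L2_set (u k) {..<n} \<le> (real k + 1) * L2_set (u 0) {..<n}"
proof -
  define dot where "dot x y = (\<Sum>i<n. x i * y i)" for x y :: "nat \<Rightarrow> real"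
  have comm: "dot x y = dot y x" for x y by (simp add: dot_def mult.commute)
  have sa: "dot (mat_app n a x) y = dot x (mat_app n a y)" for x y
    unfolding dot_def by (rule mat_app_self_adjoint[OF sym])
  have sq: "(L2_set x {..<n})\<^sup>2 = dot x x" for x
    unfolding L2_set_squared by (simp add: dot_def power2_eq_square)
  define E where "E k = dot (u (Suc k)) (u (Suc k)) + dot (u k) (u k)
    - dot (mat_app n a (u k)) (u (Suc k))" for k
  have E_Suc: "E (Suc k) = E k" for k
  proof -
    let ?v = "mat_app n a (u (Suc k))"
    have "dot (u (Suc (Suc k))) (u (Suc (Suc k))) = dot ?v ?v - 2 * dot ?v (u k) + dot (u k) (u k)"
      by (simp add: dot_def rec sum.distrib sum_subtractf sum_distrib_left algebra_simps)
    moreover have "dot ?v (u (Suc (Suc k))) = dot ?v ?v - dot ?v (u k)"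
      by (simp add: dot_def rec sum.distrib sum_subtractf algebra_simps)
    moreover have "dot ?v (u k) = dot (mat_app n a (u k)) (u (Suc k))"
      by (rule trans[OF sa comm])
    ultimately show ?thesis by (simp add: E_def)
  qed
  have E: "E k = dot (u 0) (u 0)" for k
  proof (induction k)
    case 0
    show ?case using u1 by (simp add: E_def)
  qed (simp add: E_Suc)
  \<comment> \<open>Half the image, \<open>?w\<close>, is no longer than \<open>u k\<close>.
    Completing the square in the conserved energy then bounds the norm of \<open>?z\<close> by that
    of \<open>u 0\<close>, so growth is linear.\<close>
  have step: "L2_set (u (Suc k)) {..<n} \<le> L2_set (u 0) {..<n} + L2_set (u k) {..<n}" for k
  proof -
    let ?w = "\<lambda>i. mat_app n a (u k) i / 2"
    let ?z = "\<lambda>i. u (Suc k) i - ?w i"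
    have w: "L2_set ?w {..<n} \<le> L2_set (u k) {..<n}"
      using bound[of k] L2_set_right_distrib[of "1/2" "mat_app n a (u k)" "{..<n}"] by simp
    have "dot ?z ?z = dot (u (Suc k)) (u (Suc k)) - dot (mat_app n a (u k)) (u (Suc k)) + dot ?w ?w"
      unfolding dot_def sum.distrib[symmetric] sum_subtractf[symmetric]
      by (intro sum.cong refl) (simp add: algebra_simps)
    then have "(L2_set ?z {..<n})\<^sup>2 = dot (u 0) (u 0) - (L2_set (u k) {..<n})\<^sup>2 + (L2_set ?w {..<n})\<^sup>2"
      using E[of k] unfolding sq E_def by simp
    also have "\<dots> \<le> (L2_set (u 0) {..<n})\<^sup>2"
      using power_mono[OF w, of 2] by (simp add: sq L2_set_nonneg)
    finally have z: "L2_set ?z {..<n} \<le> L2_set (u 0) {..<n}"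
      by (rule power2_le_imp_le) (simp add: L2_set_nonneg)
    have "L2_set (u (Suc k)) {..<n} \<le> L2_set ?z {..<n} + L2_set ?w {..<n}"
      using L2_set_triangle_ineq[of ?z ?w "{..<n}"] by simp
    with z w show ?thesis by linarith
  qed
  show ?thesis
  proof (induction k)
    case (Suc k)
    with step[of k] show ?case by (simp add: algebra_simps)
  qed simp
qed


section \<open>Matrix powers and iterated maps\<close>

lemma pow_mat_add:
  fixes A :: "'a :: semiring_1 mat"
  assumes A: "A \<in> carrier_mat n n"
  shows "A ^\<^sub>m (k + l) = A ^\<^sub>m k * A ^\<^sub>m l"
proof (induction l)
  case (Suc l)
  then show ?case using A by (simp add: assoc_mult_mat[of _ n n _ n _ n])
qed (use A in simp)

lemma transpose_pow_mat:
  fixes A :: "'a :: comm_semiring_1 mat"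
  assumes A: "A \<in> carrier_mat n n"
  shows "transpose_mat (A ^\<^sub>m k) = transpose_mat A ^\<^sub>m k"
proof (induction k)
  case (Suc k)
  have "transpose_mat (A ^\<^sub>m Suc k) = transpose_mat A * transpose_mat A ^\<^sub>m k"
    using A Suc by (simp add: transpose_mult[of _ n n _ n])
  also have "\<dots> = transpose_mat A ^\<^sub>m Suc k"
    using A pow_mat_add[of "transpose_mat A" n 1 k] by (simp add: pow_mat_add)
  finally show ?case .
qed (use A in simp)

text \<open>Connects the trace identity, stated for matrix powers, with the growth bound, stated for
  iterated maps.\<close>

lemma funpow_mat_app:
  assumes "i < n"
  shows "(mat_app n a ^^ m) x i = (\<Sum>j<n. (mat n n (\<lambda>(i, j). a i j) ^\<^sub>m m) $$ (i, j) * x j)"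
  using assms
proof (induction m arbitrary: x)
  case 0
  then have "(\<Sum>j<n. 1\<^sub>m n $$ (i, j) * x j) = (\<Sum>j<n. if j = i then x j else 0)"
    by (intro sum.cong) auto
  with 0 show ?case by simp
next
  case (Suc m)
  let ?A = "mat n n (\<lambda>(i, j). a i j)"
  have A: "?A ^\<^sub>m m \<in> carrier_mat n n" by (rule pow_carrier_mat) simp
  have "(mat_app n a ^^ Suc m) x i = (mat_app n a ^^ m) (mat_app n a x) i"
    by (simp only: funpow_Suc_right o_apply)
  also have "\<dots> = (\<Sum>j<n. \<Sum>l<n. (?A ^\<^sub>m m) $$ (i, j) * a j l * x l)"
    by (simp add: Suc mat_app_def sum_distrib_left mult.assoc)
  also have "\<dots> = (\<Sum>l<n. (\<Sum>j<n. (?A ^\<^sub>m m) $$ (i, j) * a j l) * x l)"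
    by (subst sum.swap) (simp add: sum_distrib_right)
  also have "\<dots> = (\<Sum>l<n. (?A ^\<^sub>m Suc m) $$ (i, l) * x l)"
    using index_mult_mat_sum[OF A _ Suc.prems, of ?A n] by (intro sum.cong refl) simp
  finally show ?case .
qed

lemma funpow_mat_app_one:
  assumes "\<And>i. i < n \<Longrightarrow> (\<Sum>j<n. a i j) = D" and "i < n"
  shows "(mat_app n a ^^ m) (\<lambda>_. 1) i = D ^ m"
  using assms(2)
proof (induction m arbitrary: i)
  case (Suc m)
  then have "(mat_app n a ^^ Suc m) (\<lambda>_. 1) i = (\<Sum>j<n. a i j * D ^ m)"
    by (simp add: mat_app_def[of n a "(mat_app n a ^^ m) x" for x])
  then show ?case using assms(1)[OF Suc.prems] by (simp add: sum_distrib_right[symmetric])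
qed simp

text \<open>On the complement of the all-ones vector, \<open>A\<^sup>m\<close> agrees with \<open>A\<^sup>m - D\<^sup>m/n J\<close>, whose squared
  Frobenius norm is \<open>tr A\<^sup>2\<^sup>m - D\<^sup>2\<^sup>m\<close>. Taking \<open>m \<rightarrow> \<infinity>\<close> thus needs no eigenvectors.\<close>

lemma mat_app_le_second_eigenvalue:
  assumes sym: "\<And>i j. i < n \<Longrightarrow> j < n \<Longrightarrow> a i j = a j i"
    and row: "\<And>i. i < n \<Longrightarrow> (\<Sum>j<n. a i j) = D"
    and es: "char_poly (mat n n (\<lambda>(i, j). a i j)) = (\<Prod>e\<leftarrow>D # es. [:- e, 1:])"
    and le: "\<And>e. e \<in> set es \<Longrightarrow> \<bar>e\<bar> \<le> r" and "r > 0" and "n > 0"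
    and x: "(\<Sum>i<n. x i) = 0"
  shows "L2_set (mat_app n a x) {..<n} \<le> r * L2_set x {..<n}"
proof (rule mat_app_le_growth_rate[OF sym])
  define A where "A = mat n n (\<lambda>(i, j). a i j)"
  have A: "A \<in> carrier_mat n n" by (simp add: A_def)
  fix m
  define P where "P i j = (A ^\<^sub>m m) $$ (i, j)" for i j
  have Am: "A ^\<^sub>m m \<in> carrier_mat n n" using A by simp
  have AT: "transpose_mat A = A" by (rule eq_matI) (auto simp: A_def sym)
  have Psym: "P i j = P j i" if "i < n" "j < n" for i j
    using that Am transpose_pow_mat[OF A, of m] unfolding AT P_def
    by (metis carrier_matD index_transpose_mat(1))
  have Prow: "(\<Sum>j<n. P i j) = D ^ m" if "i < n" for i
    using funpow_mat_app[OF that, where m = m and a = a and x = "\<lambda>_. 1"] funpow_mat_app_one[where m = m and D = D, OF row that]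
    by (simp add: P_def A_def)
  have "(\<Sum>i<n. \<Sum>j<n. (P i j)\<^sup>2) = (\<Sum>i<n. \<Sum>j<n. P i j * P j i)"
    by (intro sum.cong refl) (simp add: power2_eq_square Psym)
  also have "\<dots> = (\<Sum>i<n. (A ^\<^sub>m m * A ^\<^sub>m m) $$ (i, i))"
    using Am unfolding P_def by (intro sum.cong refl index_mult_mat_sum[OF Am Am, symmetric]) auto
  also have "A ^\<^sub>m m * A ^\<^sub>m m = A ^\<^sub>m (2 * m)"
    using A by (simp add: mult_2 pow_mat_add)
  also have "(\<Sum>i<n. (A ^\<^sub>m (2 * m)) $$ (i, i)) = D ^ (2 * m) + (\<Sum>e\<leftarrow>es. e ^ (2 * m))"
    using sum_diag_pow_mat[OF A es[folded A_def], of "2 * m"] by simp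
  finally have frob: "(\<Sum>i<n. \<Sum>j<n. (P i j)\<^sup>2) = D ^ (2 * m) + (\<Sum>e\<leftarrow>es. e ^ (2 * m))" .
  have es_le: "(\<Sum>e\<leftarrow>es. e ^ (2 * m)) \<le> length es * r ^ (2 * m)"
  proof -
    have "(\<Sum>e\<leftarrow>es. e ^ (2 * m)) \<le> (\<Sum>e\<leftarrow>es. r ^ (2 * m))"
    proof (rule sum_list_mono)
      fix e assume "e \<in> set es"
      then have "\<bar>e\<bar> ^ (2 * m) \<le> r ^ (2 * m)" using le by (intro power_mono) auto
      then show "e ^ (2 * m) \<le> r ^ (2 * m)" by (simp add: power_mult)
    qed
    then show ?thesis by (simp add: sum_list_triv)
  qed
  define R where "R i j = P i j - D ^ m / n" for i j
  have "(R i j)\<^sup>2 = (P i j)\<^sup>2 - 2 * (D ^ m / n) * P i j + (D ^ m / n)\<^sup>2" for i j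
    by (simp add: R_def power2_eq_square algebra_simps)
  then have "(\<Sum>i<n. \<Sum>j<n. (R i j)\<^sup>2)
      = (\<Sum>i<n. \<Sum>j<n. (P i j)\<^sup>2) - 2 * (D ^ m / n) * (\<Sum>i<n. \<Sum>j<n. P i j) + n * (n * (D ^ m / n)\<^sup>2)"
    by (simp add: sum.distrib sum_subtractf sum_distrib_left)
  also have "(\<Sum>i<n. \<Sum>j<n. P i j) = n * D ^ m" by (simp add: Prow)
  also have "(\<Sum>i<n. \<Sum>j<n. (P i j)\<^sup>2) - 2 * (D ^ m / n) * (n * D ^ m) + n * (n * (D ^ m / n)\<^sup>2)
      = (\<Sum>e\<leftarrow>es. e ^ (2 * m))"
  proof -
    \<comment> \<open>The cross term contributes \<open>-2 D^(2m)\<close> and the constant part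
      \<open>D^(2m)\<close>, so together they remove the top eigenvalue from the power sum.\<close>
    have "2 * (D ^ m / n) * (n * D ^ m) = 2 * (D ^ m)\<^sup>2" "n * (n * (D ^ m / n)\<^sup>2) = (D ^ m)\<^sup>2"
      using \<open>n > 0\<close> by (simp_all add: power2_eq_square)
    then show ?thesis unfolding frob by (simp add: power_mult[symmetric] mult.commute)
  qed
  finally have R: "(\<Sum>i<n. \<Sum>j<n. (R i j)\<^sup>2) \<le> length es * r ^ (2 * m)" using es_le by simp
  \<comment> \<open>The entries of \<open>x\<close> sum to 0, so the subtracted constant matrix
    annihilates it. Cauchy-Schwarz in each row then brings in the Frobenius norm of
    \<open>R\<close>.\<close>
  have "(L2_set ((mat_app n a ^^ m) x) {..<n})\<^sup>2 = (\<Sum>i<n. (\<Sum>j<n. R i j * x j)\<^sup>2)"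
    unfolding L2_set_squared
  proof (intro sum.cong refl)
    fix i assume "i \<in> {..<n}"
    then have "(mat_app n a ^^ m) x i = (\<Sum>j<n. P i j * x j)"
      using funpow_mat_app[where m = m and a = a and x = x and i = i and n = n] by (simp add: P_def A_def)
    also have "\<dots> = (\<Sum>j<n. R i j * x j) + D ^ m / n * (\<Sum>j<n. x j)"
      by (simp only: R_def sum_distrib_left sum.distrib[symmetric]) (simp add: algebra_simps)
    finally show "((mat_app n a ^^ m) x i)\<^sup>2 = (\<Sum>j<n. R i j * x j)\<^sup>2" using x by simp
  qed
  also have "\<dots> \<le> (\<Sum>i<n. (\<Sum>j<n. (R i j)\<^sup>2) * (L2_set x {..<n})\<^sup>2)"
  proof (rule sum_mono)
    fix i
    have "\<bar>\<Sum>j<n. R i j * x j\<bar> \<le> L2_set (R i) {..<n} * L2_set x {..<n}"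
      by (rule order_trans[OF sum_abs]) (simp add: abs_mult L2_set_mult_ineq)
    then have "\<bar>\<Sum>j<n. R i j * x j\<bar>\<^sup>2 \<le> (L2_set (R i) {..<n} * L2_set x {..<n})\<^sup>2"
      by (rule power_mono) simp
    then show "(\<Sum>j<n. R i j * x j)\<^sup>2 \<le> (\<Sum>j<n. (R i j)\<^sup>2) * (L2_set x {..<n})\<^sup>2"
      by (simp add: power_mult_distrib L2_set_squared)
  qed
  also have "\<dots> \<le> (length es * r ^ (2 * m)) * (L2_set x {..<n})\<^sup>2"
    using R by (simp add: sum_distrib_right[symmetric] mult_right_mono)
  also have "\<dots> = (sqrt (length es) * L2_set x {..<n} * r ^ m)\<^sup>2"
    by (simp add: power_mult_distrib power_mult[symmetric] mult.commute)
  finally show "L2_set ((mat_app n a ^^ m) x) {..<n} \<le> sqrt (length es) * L2_set x {..<n} * r ^ m"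
    by (rule power2_le_imp_le) (use \<open>r > 0\<close> in \<open>simp add: L2_set_nonneg\<close>)
qed (use \<open>r > 0\<close> in auto)

section \<open>The spectrum of a Ramanujan graph\<close>

text \<open>All \<open>n\<close> roots are real by \<open>length_graph_eigenvalues\<close>, so the
  characteristic polynomial splits over the reals.\<close>

lemma char_poly_graph_eigenvalues:
  assumes "pair_graph G"
  shows "char_poly (adjacency_matrix n G) = (\<Prod>e\<leftarrow>graph_eigenvalues n G. [:- e, 1:])"
proof -
  let ?p = "char_poly (adjacency_matrix n G)"
  have A: "adjacency_matrix n G \<in> carrier_mat n n" by (simp add: adjacency_matrix_def)
  have mset: "mset (graph_eigenvalues n G) = proots ?p"
    by (simp add: graph_eigenvalues_def)
  then have "size (proots ?p) = degree ?p"
    using length_graph_eigenvalues[OF assms, of n] degree_monic_char_poly[OF A] by (metis size_mset)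
  with degree_monic_char_poly[OF A] have "?p = (\<Prod>e\<in>#proots ?p. [:- e, 1:])"
    by (intro monic_eq_prod_proots) auto
  also have "\<dots> = (\<Prod>e\<leftarrow>graph_eigenvalues n G. [:- e, 1:])"
    unfolding mset[symmetric] by (simp flip: prod_mset_prod_list mset_map)
  finally show ?thesis .
qed

lemma ramanujan_card_neighbours:
  assumes "ramanujan_graph n d G" and "i < n"
  shows "card (parcs G `` {i}) = d"
proof -
  have "out_arcs (with_proj G) i = Pair i ` (parcs G `` {i})"
    by (auto simp: out_arcs_def)
  moreover have "card (out_arcs (with_proj G) i) = d"
    using assms by (simp add: ramanujan_graph_def out_degree_def)
  ultimately show ?thesis by (simp add: card_image inj_on_def)
qed

lemma ramanujan_row_sum:
  assumes "ramanujan_graph n d G" and "i < n"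
  shows "(\<Sum>j<n. of_bool ((i, j) \<in> parcs G) :: real) = d"
proof -
  interpret pair_graph G using assms by (simp add: ramanujan_graph_def)
  have "parcs G `` {i} = {..<n} \<inter> {j. (i, j) \<in> parcs G}"
    using assms arc_snd_in_verts by (fastforce simp: ramanujan_graph_def)
  then show ?thesis using ramanujan_card_neighbours[OF assms] by simp
qed

text \<open>The definition bounds all eigenvalues but the first without naming the first. The
  all-ones vector shows that \<open>d\<close> is an eigenvalue, and \<open>d\<close> is too large
  for a bounded position, so it must stand first.\<close>

lemma ramanujan_mat_app_le:
  assumes G: "ramanujan_graph n d G" and "d \<ge> 3" and "n > 0" and x: "(\<Sum>i<n. x i) = 0"
  shows "L2_set (mat_app n (\<lambda>i j. of_bool ((i, j) \<in> parcs G)) x) {..<n}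
    \<le> 2 * sqrt (real d - 1) * L2_set x {..<n}"
proof -
  interpret pair_graph G using G by (simp add: ramanujan_graph_def)
  let ?a = "\<lambda>i j. of_bool ((i, j) \<in> parcs G) :: real"
  let ?es = "graph_eigenvalues n G"
  define A where "A = adjacency_matrix n G"
  have A: "A \<in> carrier_mat n n" by (simp add: A_def adjacency_matrix_def)
  have A_eq: "A = mat n n (\<lambda>(i, j). ?a i j)"
    by (auto simp: A_def adjacency_matrix_def)
  have cp: "char_poly A = (\<Prod>e\<leftarrow>?es. [:- e, 1:])"
    unfolding A_def by (intro char_poly_graph_eigenvalues) unfold_locales
  have len: "length ?es = n" by (intro length_graph_eigenvalues) unfold_locales
  have small: "\<bar>?es ! i\<bar> \<le> 2 * sqrt (real d - 1)" if "i < n" "i \<noteq> 0" for i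
    using G that by (auto simp: ramanujan_graph_def)
  have "eigenvector A (vec n (\<lambda>_. 1)) (real d)"
    unfolding eigenvector_def
  proof (intro conjI)
    show "vec n (\<lambda>_. 1 :: real) \<noteq> 0\<^sub>v (dim_row A)" using A \<open>n > 0\<close> by (auto simp: vec_eq_iff)
    show "A *\<^sub>v vec n (\<lambda>_. 1) = real d \<cdot>\<^sub>v vec n (\<lambda>_. 1)"
      using ramanujan_row_sum[OF G]
      by (intro eq_vecI) (simp_all add: A_eq scalar_prod_def lessThan_atLeast0)
  qed (use A in simp)
  then have "poly (char_poly A) (real d) = 0"
    using eigenvalue_root_char_poly[OF A] by (auto simp: eigenvalue_def)
  then have "real d \<in> set ?es" unfolding cp by (auto simp: poly_prod_list prod_list_zero_iff)
  then obtain i where i: "i < n" "?es ! i = real d" by (metis in_set_conv_nth len)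
  \<comment> \<open>Multiplied out, \<open>4 * (d - 1) < d^2\<close> is
    \<open>(d - 2)^2 > 0\<close>.\<close>
  have "(2 * sqrt (real d - 1))\<^sup>2 < (real d)\<^sup>2"
  proof -
    have "0 < (real d - 2)\<^sup>2" using \<open>d \<ge> 3\<close> by simp
    then show ?thesis using \<open>d \<ge> 3\<close> by (simp add: power_mult_distrib power2_eq_square algebra_simps)
  qed
  then have less: "2 * sqrt (real d - 1) < real d" by (rule power2_less_imp_less) simp
  with small i have "i = 0" by fastforce
  with i obtain es where es: "?es = real d # es" using len \<open>n > 0\<close> by (cases ?es) auto
  have "\<bar>e\<bar> \<le> 2 * sqrt (real d - 1)" if "e \<in> set es" for e
  proof -
    from that obtain j where "j < length es" "e = es ! j" by (auto simp: in_set_conv_nth)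
    then show ?thesis using small[of "Suc j"] len by (simp add: es)
  qed
  moreover have "(i, j) \<in> parcs G \<longleftrightarrow> (j, i) \<in> parcs G" for i j
    using sym_arcs by (auto simp: symmetric_def sym_def)
  ultimately show ?thesis using assms cp ramanujan_row_sum[OF G]
    by (intro mat_app_le_second_eigenvalue[where D = "real d" and es = es]) (simp_all add: A_eq[symmetric] es)
qed

section \<open>Nodes far from a given node\<close>

definition graph_ball :: "('a \<times> 'a) set \<Rightarrow> 'a \<Rightarrow> nat \<Rightarrow> 'a set" where
  "graph_ball E r m = {v. \<exists>j\<le>m. (r, v) \<in> E ^^ j}"

text \<open>This is \<open>U_k(M / 2) x\<close> for the matrix \<open>M\<close> with entries
  \<open>a\<close> and the Chebyshev polynomials \<open>U_k\<close> of the second kind. The scaling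
  by 1/2 absorbs the factor 2 of their recurrence.\<close>

fun chebyshev_iterate ::
    "nat \<Rightarrow> (nat \<Rightarrow> nat \<Rightarrow> real) \<Rightarrow> (nat \<Rightarrow> real) \<Rightarrow> nat \<Rightarrow> nat \<Rightarrow> real" where
  "chebyshev_iterate n a x 0 = x"
| "chebyshev_iterate n a x (Suc 0) = mat_app n a x"
| "chebyshev_iterate n a x (Suc (Suc k)) =
     (\<lambda>i. mat_app n a (chebyshev_iterate n a x (Suc k)) i - chebyshev_iterate n a x k i)"

text \<open>The scalar \<open>U_k(y / 2)\<close>, by which \<open>U_k(M / 2)\<close> multiplies an
  eigenvector of \<open>M\<close> for the eigenvalue \<open>y\<close>.\<close>

fun chebyshev_value :: "real \<Rightarrow> nat \<Rightarrow> real" where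
  "chebyshev_value y 0 = 1"
| "chebyshev_value y (Suc 0) = y"
| "chebyshev_value y (Suc (Suc k)) = y * chebyshev_value y (Suc k) - chebyshev_value y k"

text \<open>At \<open>w + 1 / w\<close> the recurrence has the characteristic roots \<open>w\<close>
  and \<open>1 / w\<close>, so the deviation from growth by the factor \<open>w\<close> is geometric
  with ratio \<open>1 / w\<close>.\<close>

lemma chebyshev_value_Suc:
  assumes "w \<noteq> 0"
  shows "chebyshev_value (w + 1 / w) (Suc k) = w * chebyshev_value (w + 1 / w) k + (1 / w) ^ Suc k"
proof (induction k)
  case (Suc k)
  have "chebyshev_value (w + 1 / w) (Suc (Suc k)) = w * chebyshev_value (w + 1 / w) (Suc k)
      + 1 / w * (chebyshev_value (w + 1 / w) (Suc k) - w * chebyshev_value (w + 1 / w) k)"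
    using assms by (simp add: algebra_simps)
  also have "chebyshev_value (w + 1 / w) (Suc k) - w * chebyshev_value (w + 1 / w) k = (1 / w) ^ Suc k"
    using Suc by simp
  finally show ?case by simp
qed simp

lemma chebyshev_value_ge:
  assumes "w > 0"
  shows "chebyshev_value (w + 1 / w) k \<ge> w ^ k"
proof (induction k)
  case (Suc k)
  have "w * w ^ k \<le> w * chebyshev_value (w + 1 / w) k" using Suc assms by simp
  moreover have "(1 / w) ^ Suc k \<ge> 0" using assms by simp
  ultimately show ?case
    using chebyshev_value_Suc[OF less_imp_neq[OF assms, symmetric], of k] unfolding power_Suc by linarith
qed simp

lemma mat_app_add: "mat_app n a (\<lambda>i. x i + y i) i = mat_app n a x i + mat_app n a y i"
  by (simp add: mat_app_def sum.distrib algebra_simps)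

lemma mat_app_const:
  assumes "\<And>i. i < n \<Longrightarrow> (\<Sum>j<n. a i j) = D" and "i < n"
  shows "mat_app n a (\<lambda>_. c) i = D * c"
  using assms by (simp add: mat_app_def sum_distrib_right[symmetric])

lemma mat_app_cong:
  assumes "\<And>i. i < n \<Longrightarrow> x i = y i"
  shows "mat_app n a x = mat_app n a y"
  using assms by (simp add: mat_app_def fun_eq_iff)

lemma sum_mat_app:
  assumes sym: "\<And>i j. i < n \<Longrightarrow> j < n \<Longrightarrow> a i j = a j i"
    and row: "\<And>i. i < n \<Longrightarrow> (\<Sum>j<n. a i j) = D"
  shows "(\<Sum>i<n. mat_app n a x i) = D * (\<Sum>i<n. x i)"
proof -
  have "(\<Sum>i<n. mat_app n a x i * 1) = (\<Sum>i<n. x i * mat_app n a (\<lambda>_. 1) i)"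
    by (rule mat_app_self_adjoint[OF sym])
  also have "\<dots> = (\<Sum>i<n. x i * D)" using mat_app_const[of n a D _ 1] row by simp
  finally show ?thesis by (simp add: sum_distrib_left mult.commute)
qed

text \<open>The constant part is an eigenvector and evolves on its own. This separates the mean of
  an indicator from its sum-zero rest.\<close>

lemma chebyshev_iterate_add_const:
  assumes row: "\<And>i. i < n \<Longrightarrow> (\<Sum>j<n. a i j) = D" and "i < n"
  shows "chebyshev_iterate n a (\<lambda>i. x i + c) k i = chebyshev_iterate n a x k i + c * chebyshev_value D k"
  using \<open>i < n\<close>
proof (induction k arbitrary: i rule: induct_nat_012)
  case 1
  then show ?case using mat_app_const[of n a D i c] row by (simp add: mat_app_add)
next
  case (ge2 k)
  have "mat_app n a (chebyshev_iterate n a (\<lambda>i. x i + c) (Suc k)) i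
      = mat_app n a (\<lambda>i. chebyshev_iterate n a x (Suc k) i + c * chebyshev_value D (Suc k)) i"
    using ge2.IH(2) by (subst mat_app_cong) auto
  also have "\<dots> = mat_app n a (chebyshev_iterate n a x (Suc k)) i + D * (c * chebyshev_value D (Suc k))"
    using mat_app_const[of n a D i] row ge2.prems by (simp only: mat_app_add)
  finally show ?case using ge2 by (simp add: algebra_simps)
qed simp

text \<open>Keeps the iterates in the subspace on which the spectral gap gives a norm bound.\<close>

lemma sum_chebyshev_iterate:
  assumes sym: "\<And>i j. i < n \<Longrightarrow> j < n \<Longrightarrow> a i j = a j i"
    and row: "\<And>i. i < n \<Longrightarrow> (\<Sum>j<n. a i j) = D" and "(\<Sum>i<n. x i) = 0"
  shows "(\<Sum>i<n. chebyshev_iterate n a x k i) = 0"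
  using assms(3) by (induction k rule: induct_nat_012) (simp_all add: sum_mat_app[OF sym row] sum_subtractf)

text \<open>A polynomial of degree \<open>k\<close> in the matrix spreads the support by at most
  \<open>k\<close> arcs.\<close>

lemma chebyshev_iterate_support:
  assumes sym: "\<And>i j. (i, j) \<in> E \<Longrightarrow> (j, i) \<in> E"
    and a: "\<And>i j. a i j \<noteq> 0 \<Longrightarrow> (i, j) \<in> E"
    and "i \<notin> graph_ball E s k"
  shows "chebyshev_iterate n a (\<lambda>i. of_bool (i = s)) k i = 0"
proof -
  have step: "mat_app n a y i = 0"
    if y: "\<And>j. j \<notin> graph_ball E s m \<Longrightarrow> y j = 0" and i: "i \<notin> graph_ball E s (Suc m)" for y i m
  proof -
    have "a i j * y j = 0" for j
    proof (rule ccontr)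
      assume "a i j * y j \<noteq> 0"
      then have "(j, i) \<in> E" and "j \<in> graph_ball E s m" using y a sym by fastforce+
      then obtain l where "l \<le> m" "(s, j) \<in> E ^^ l" by (auto simp: graph_ball_def)
      with \<open>(j, i) \<in> E\<close> have "(s, i) \<in> E ^^ Suc l" by auto
      with \<open>l \<le> m\<close> i show False unfolding graph_ball_def by (metis (mono_tags, lifting) Suc_le_mono mem_Collect_eq)
    qed
    then show ?thesis by (simp add: mat_app_def)
  qed
  have mono: "graph_ball E s l \<subseteq> graph_ball E s m" if "l \<le> m" for l m
    using that by (auto simp: graph_ball_def intro: order_trans)
  have base: "i \<notin> graph_ball E s 0 \<Longrightarrow> of_bool (i = s) = (0 :: real)" for i
    by (auto simp: graph_ball_def)
  show ?thesis using assms(3)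
  proof (induction k arbitrary: i rule: induct_nat_012)
    case 0
    then show ?case using base by simp
  next
    case 1
    then show ?case using step[of 0 "\<lambda>i. of_bool (i = s)" i] base by simp
  next
    case (ge2 k)
    have "mat_app n a (chebyshev_iterate n a (\<lambda>i. of_bool (i = s)) (Suc k)) i = 0"
      using ge2 by (intro step[of "Suc k"])
    moreover have "chebyshev_iterate n a (\<lambda>i. of_bool (i = s)) k i = 0"
      using ge2.prems mono[of k "Suc (Suc k)"] by (intro ge2.IH(1)) auto
    ultimately show ?case by simp
  qed
qed

text \<open>A second-moment count. Outside the ball the iterate of the indicator vanishes, so its
  sum-zero part equals \<open>- c / n\<close> there. Each such node contributes at least
  \<open>(d - 1)^k / n^2\<close> to a squared norm of at most \<open>(k + 1)^2\<close>.\<close>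

lemma ramanujan_card_outside_ball:
  assumes G: "ramanujan_graph n d G" and "d \<ge> 3" and s: "s < n"
  shows "real (card ({..<n} - graph_ball (parcs G) s k)) \<le> (real n * (real k + 1))\<^sup>2 / (real d - 1) ^ k"
proof -
  interpret pair_graph G using G by (simp add: ramanujan_graph_def)
  have E_sym: "(i, j) \<in> parcs G \<Longrightarrow> (j, i) \<in> parcs G" for i j
    using sym_arcs by (auto simp: symmetric_def sym_def)
  have n: "n > 0" using s by simp
  define w where "w = sqrt (real d - 1)"
  have w: "w > 0" "w\<^sup>2 = real d - 1" using \<open>d \<ge> 3\<close> by (simp_all add: w_def)
  \<comment> \<open>Division by \<open>w\<close> scales the gap bound \<open>2 * w\<close> to the 2
    that the Chebyshev recurrence requires.\<close>
  define a where "a i j = of_bool ((i, j) \<in> parcs G) / w" for i j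
  define x where "x i = of_bool (i = s) - 1 / real n" for i
  define u where "u = chebyshev_iterate n a x"
  define c where "c = chebyshev_value (w + 1 / w) k"
  have sym: "a i j = a j i" for i j using E_sym by (auto simp: a_def)
  have row: "(\<Sum>j<n. a i j) = w + 1 / w" if "i < n" for i
  proof -
    have "(\<Sum>j<n. a i j) = real d / w"
      using ramanujan_row_sum[OF G that] by (simp add: a_def sum_divide_distrib[symmetric])
    \<comment> \<open>Here \<open>d = w^2 + 1\<close>, so the row sum has the form at which the
      Chebyshev values are at least \<open>w ^ k\<close>.\<close>
    also have "\<dots> = w + 1 / w" using w by (simp add: field_simps power2_eq_square)
    finally show ?thesis .
  qed
  have sum_s: "(\<Sum>i<n. of_bool (i = s) :: real) = 1" using s by (simp add: of_bool_def)
  have x_sum: "(\<Sum>i<n. x i) = 0" using n by (simp add: x_def sum_subtractf sum_s)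
  have bound: "L2_set (mat_app n a (u k)) {..<n} \<le> 2 * L2_set (u k) {..<n}" for k
  proof -
    have "mat_app n a (u k) = (\<lambda>i. 1 / w * mat_app n (\<lambda>i j. of_bool ((i, j) \<in> parcs G)) (u k) i)"
      unfolding mat_app_def a_def sum_distrib_left by (intro ext sum.cong refl) simp
    then have "L2_set (mat_app n a (u k)) {..<n}
        = 1 / w * L2_set (mat_app n (\<lambda>i j. of_bool ((i, j) \<in> parcs G)) (u k)) {..<n}"
      using w by (simp only:) (rule L2_set_right_distrib[symmetric], simp)
    also have "\<dots> \<le> 1 / w * (2 * w * L2_set (u k) {..<n})"
      using ramanujan_mat_app_le[OF G \<open>d \<ge> 3\<close> n, of "u k"] sum_chebyshev_iterate[OF sym row x_sum] w
      by (intro mult_left_mono) (simp_all add: u_def w_def)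
    finally show ?thesis using w by simp
  qed
  have "(L2_set x {..<n})\<^sup>2 = (\<Sum>i<n. of_bool (i = s) - 2 / n * of_bool (i = s) + 1 / (real n)\<^sup>2)"
    unfolding L2_set_squared x_def by (intro sum.cong) (auto simp: power2_eq_square algebra_simps)
  also have "\<dots> = 1 - 1 / n"
    using n by (simp add: sum.distrib sum_subtractf sum_distrib_left[symmetric] sum_divide_distrib[symmetric] sum_s power2_eq_square)
  finally have "(L2_set x {..<n})\<^sup>2 \<le> 1\<^sup>2" by simp
  then have "L2_set x {..<n} \<le> 1" by (rule power2_le_imp_le) simp
  moreover have "L2_set (u k) {..<n} \<le> (real k + 1) * L2_set (u 0) {..<n}"
    by (rule chebyshev_recurrence_bound[OF sym bound]) (simp_all add: u_def)
  ultimately have u_le: "L2_set (u k) {..<n} \<le> real k + 1"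
    by (smt (verit) mult_left_le of_nat_0_le_iff u_def chebyshev_iterate.simps(1))
  define F where "F = {..<n} - graph_ball (parcs G) s k"
  have far: "(u k i)\<^sup>2 = (c / n)\<^sup>2" if "i \<in> F" for i
  proof -
    have "(\<lambda>i. x i + 1 / n) = (\<lambda>i. of_bool (i = s))" by (simp add: x_def)
    then have "u k i + 1 / n * c = chebyshev_iterate n a (\<lambda>i. of_bool (i = s)) k i"
      using chebyshev_iterate_add_const[of n a "w + 1 / w" i x "1 / n" k] row that
      by (simp add: u_def c_def F_def)
    also have "\<dots> = 0"
      using that E_sym by (intro chebyshev_iterate_support[where E = "parcs G"]) (auto simp: a_def F_def)
    finally have "u k i = - (c / n)" by simp
    then show ?thesis by simp
  qed
  have "w ^ k \<le> c" unfolding c_def by (rule chebyshev_value_ge[OF w(1)])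
  then have "(w ^ k)\<^sup>2 \<le> c\<^sup>2" using w by (intro power_mono) auto
  moreover have "(w ^ k)\<^sup>2 = (real d - 1) ^ k" by (simp add: w(2)[symmetric] power_mult[symmetric] mult.commute)
  ultimately have c: "(real d - 1) ^ k \<le> c\<^sup>2" by simp
  have "card F * ((real d - 1) ^ k / (real n)\<^sup>2) \<le> card F * (c / n)\<^sup>2"
    using c by (intro mult_left_mono) (simp_all add: power_divide divide_right_mono)
  also have "\<dots> = (\<Sum>i\<in>F. (u k i)\<^sup>2)" using far by simp
  also have "\<dots> \<le> (\<Sum>i<n. (u k i)\<^sup>2)" by (rule sum_mono2) (auto simp: F_def)
  also have "\<dots> = (L2_set (u k) {..<n})\<^sup>2" by (rule L2_set_squared[symmetric])
  also have "\<dots> \<le> (real k + 1)\<^sup>2" using u_le by (intro power_mono) auto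
  finally show ?thesis using n \<open>d \<ge> 3\<close> unfolding F_def[symmetric] power_mult_distrib
    by (simp add: field_simps)
qed

section \<open>Balls and shortest walks\<close>

definition graph_sphere :: "('a \<times> 'a) set \<Rightarrow> 'a \<Rightarrow> nat \<Rightarrow> 'a set" where
  "graph_sphere E r m = {v. (r, v) \<in> E ^^ m \<and> (\<forall>j<m. (r, v) \<notin> E ^^ j)}"

definition graph_dist :: "('a \<times> 'a) set \<Rightarrow> 'a \<Rightarrow> 'a \<Rightarrow> nat" where
  "graph_dist E r v = (LEAST m. (r, v) \<in> E ^^ m)"

lemma graph_dist_le: "(r, v) \<in> E ^^ m \<Longrightarrow> graph_dist E r v \<le> m"
  unfolding graph_dist_def by (rule Least_le)

lemma graph_dist_relpow: "(r, v) \<in> E ^^ m \<Longrightarrow> (r, v) \<in> E ^^ graph_dist E r v"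
  unfolding graph_dist_def by (rule LeastI)

lemma graph_dist_sphere: "v \<in> graph_sphere E r m \<Longrightarrow> graph_dist E r v = m"
  unfolding graph_dist_def graph_sphere_def by (auto intro!: Least_equality simp: not_less[symmetric])

lemma graph_dist_ball: "v \<in> graph_ball E r m \<Longrightarrow> graph_dist E r v \<le> m"
  by (auto simp: graph_ball_def dest: graph_dist_le)

lemma graph_ball_0: "graph_ball E r 0 = {r}"
  by (auto simp: graph_ball_def)

lemma graph_sphere_0: "graph_sphere E r 0 = {r}"
  by (auto simp: graph_sphere_def)

lemma graph_ball_Suc: "graph_ball E r (Suc m) = graph_ball E r m \<union> graph_sphere E r (Suc m)"
  by (auto simp: graph_ball_def graph_sphere_def le_Suc_eq less_Suc_eq_le simp del: relpow.simps)

lemma graph_ball_mono: "l \<le> m \<Longrightarrow> graph_ball E r l \<subseteq> graph_ball E r m"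
  by (auto simp: graph_ball_def intro: order_trans)

lemma graph_ball_Suc_Image: "graph_ball E r (Suc m) = insert r (E `` graph_ball E r m)"
proof (intro equalityI subsetI)
  fix v assume "v \<in> graph_ball E r (Suc m)"
  then obtain j where j: "j \<le> Suc m" "(r, v) \<in> E ^^ j" by (auto simp: graph_ball_def)
  then show "v \<in> insert r (E `` graph_ball E r m)"
    by (cases j) (auto simp: graph_ball_def)
next
  fix v assume "v \<in> insert r (E `` graph_ball E r m)"
  then consider "v = r" | j u where "j \<le> m" "(r, u) \<in> E ^^ j" "(u, v) \<in> E"
    by (auto simp: graph_ball_def)
  then show "v \<in> graph_ball E r (Suc m)"
  proof cases
    case 1
    then show ?thesis by (auto simp: graph_ball_def intro!: exI[of _ 0])
  next
    case 2
    then show ?thesis by (auto simp: graph_ball_def intro!: exI[of _ "Suc j"])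
  qed
qed

text \<open>The last but one node of a shortest walk is itself at distance \<open>m\<close>, for a
  shorter walk to it would shorten the whole. This is the shape in which \<open>bfs_discover\<close>
  finds nodes.\<close>

lemma graph_sphere_Suc_conv: "v \<in> graph_sphere E r (Suc m) \<longleftrightarrow>
    v \<notin> graph_ball E r m \<and> (\<exists>u\<in>graph_sphere E r m. (u, v) \<in> E)"
proof
  assume v: "v \<in> graph_sphere E r (Suc m)"
  then obtain u where u: "(r, u) \<in> E ^^ m" "(u, v) \<in> E" by (auto simp: graph_sphere_def)
  have "(r, u) \<notin> E ^^ j" if "j < m" for j
  proof
    assume "(r, u) \<in> E ^^ j"
    with u have "(r, v) \<in> E ^^ Suc j" by auto
    with v that show False unfolding graph_sphere_def by (metis (mono_tags, lifting) Suc_less_eq mem_Collect_eq)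
  qed
  with u v show "v \<notin> graph_ball E r m \<and> (\<exists>u\<in>graph_sphere E r m. (u, v) \<in> E)"
    by (auto simp: graph_sphere_def graph_ball_def)
next
  assume "v \<notin> graph_ball E r m \<and> (\<exists>u\<in>graph_sphere E r m. (u, v) \<in> E)"
  then show "v \<in> graph_sphere E r (Suc m)"
    by (auto simp: graph_sphere_def graph_ball_def less_Suc_eq_le)
qed

lemma sym_relpow: "sym E \<Longrightarrow> (u, v) \<in> E ^^ m \<Longrightarrow> (v, u) \<in> E ^^ m"
proof (induction m arbitrary: v)
  case (Suc m)
  then obtain w where "(u, w) \<in> E ^^ m" "(w, v) \<in> E" by auto
  with Suc show ?case by (meson relpow_Suc_I2 symE)
qed auto

text \<open>A walk of length at most \<open>a + b\<close> can be cut into a piece of length at most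
  \<open>a\<close> and one of length at most \<open>b\<close>; the cut node lies in both
  balls.\<close>

lemma disjoint_balls_dist:
  assumes "sym E" and t: "(s, t) \<in> E ^^ D" and disj: "graph_ball E s a \<inter> graph_ball E t b = {}"
  shows "a + b < D"
proof (rule ccontr)
  assume "\<not> a + b < D"
  then have "D = min a D + (D - min a D)" "D - min a D \<le> b" by auto
  then obtain v where "(s, v) \<in> E ^^ min a D" "(v, t) \<in> E ^^ (D - min a D)"
    using t by (metis relcompE relpow_add prod.inject)
  with sym_relpow[OF \<open>sym E\<close>] \<open>D - min a D \<le> b\<close>
  have "v \<in> graph_ball E s a" "v \<in> graph_ball E t b"
    unfolding graph_ball_def by (auto intro: min.cobounded1)
  with disj show False by auto
qed

lemma finite_graph_ball:
  assumes "finite E"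
  shows "finite (graph_ball E r m)"
  by (induction m) (use assms in \<open>simp_all add: graph_ball_0 graph_ball_Suc_Image finite_Image\<close>)

text \<open>A node of a positive layer has a neighbour in the previous one, so at most \<open>d - 1\<close> in the next.\<close>

lemma card_graph_sphere_Suc_le:
  assumes fin: "finite E" and E: "sym E" and deg: "\<And>v. card (E `` {v}) \<le> d"
  shows "card (graph_sphere E r (Suc m)) \<le> d * (d - 1) ^ m"
proof (induction m)
  case 0
  have "graph_sphere E r (Suc 0) \<subseteq> E `` {r}" by (auto simp: graph_sphere_def)
  from card_mono[OF finite_Image[OF fin] this] deg[of r] show ?case by simp
next
  case (Suc m)
  let ?S = "graph_sphere E r (Suc m)"
  have S_fin: "finite ?S" using finite_graph_ball[OF fin, of r "Suc m"] by (simp add: graph_ball_Suc)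
  have "graph_sphere E r (Suc (Suc m)) \<subseteq> (\<Union>v\<in>?S. E `` {v} - graph_ball E r (Suc m))"
    by (auto simp: graph_sphere_Suc_conv[of _ E r "Suc m"])
  then have "card (graph_sphere E r (Suc (Suc m))) \<le> card (\<Union>v\<in>?S. E `` {v} - graph_ball E r (Suc m))"
    using fin S_fin by (intro card_mono finite_UN_I finite_Diff finite_Image)
  also have "\<dots> \<le> (\<Sum>v\<in>?S. card (E `` {v} - graph_ball E r (Suc m)))"
    by (rule card_UN_le[OF S_fin])
  also have "\<dots> \<le> (\<Sum>v\<in>?S. d - 1)"
  proof (rule sum_mono)
    fix v assume "v \<in> ?S"
    then obtain u where u: "u \<in> graph_sphere E r m" "(u, v) \<in> E" by (auto simp: graph_sphere_Suc_conv)
    then have "u \<in> graph_ball E r (Suc m)" by (auto simp: graph_ball_def graph_sphere_def intro: le_SucI)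
    then have "E `` {v} - graph_ball E r (Suc m) \<subseteq> E `` {v} - {u}" by auto
    then have "card (E `` {v} - graph_ball E r (Suc m)) \<le> card (E `` {v} - {u})"
      using fin by (intro card_mono finite_Diff finite_Image)
    also have "\<dots> = card (E `` {v}) - 1"
      using u E by (intro card_Diff_singleton) (auto dest: symD)
    finally show "card (E `` {v} - graph_ball E r (Suc m)) \<le> d - 1" using deg[of v] by simp
  qed
  also have "\<dots> \<le> d * (d - 1) ^ Suc m" using Suc by (simp add: mult.commute mult.left_commute)
  finally show ?case .
qed

text \<open>The factor 2 sums the geometric series: a new sphere costs at most half of the old
  bound, and \<open>3 <= 2 * (d - 1)\<close> holds from \<open>d = 3\<close> on.\<close>

lemma card_graph_ball_le:
  assumes fin: "finite E" and E: "sym E" and deg: "\<And>v. card (E `` {v}) \<le> d" and "d \<ge> 3"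
  shows "card (graph_ball E r m) \<le> 2 * d * (d - 1) ^ m"
proof (induction m)
  case 0
  show ?case using \<open>d \<ge> 3\<close> by (simp add: graph_ball_0)
next
  case (Suc m)
  have "card (graph_ball E r (Suc m)) \<le> card (graph_ball E r m) + card (graph_sphere E r (Suc m))"
    unfolding graph_ball_Suc by (rule card_Un_le)
  also have "\<dots> \<le> 3 * d * (d - 1) ^ m"
    using Suc card_graph_sphere_Suc_le[OF fin E deg, of r m] by simp
  also have "\<dots> \<le> 2 * d * (d - 1) * (d - 1) ^ m" using \<open>d \<ge> 3\<close> by (intro mult_right_mono) auto
  finally show ?case by (simp add: mult_ac)
qed

section \<open>Walks as node lists\<close>

definition walk_betw :: "('a \<times> 'a) set \<Rightarrow> 'a \<Rightarrow> 'a \<Rightarrow> 'a list \<Rightarrow> bool" where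
  "walk_betw E u v p \<longleftrightarrow> p \<noteq> [] \<and> hd p = u \<and> last p = v \<and> successively (\<lambda>x y. (x, y) \<in> E) p"

lemma walk_betw_singleton: "walk_betw E u u [u]"
  by (simp add: walk_betw_def)

lemma walk_betw_snoc: "walk_betw E u v p \<Longrightarrow> (v, w) \<in> E \<Longrightarrow> walk_betw E u w (p @ [w])"
  by (auto simp: walk_betw_def successively_append_iff)

lemma walk_betw_rev: "sym E \<Longrightarrow> walk_betw E u v p \<Longrightarrow> walk_betw E v u (rev p)"
  by (auto simp: walk_betw_def hd_rev last_rev elim!: successively_mono dest: symD)

lemma walk_betw_join:
  "walk_betw E u v p \<Longrightarrow> walk_betw E v w q \<Longrightarrow> walk_betw E u w (p @ tl q)"
  by (cases q) (auto simp: walk_betw_def successively_append_iff successively_Cons)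

lemma walk_betw_relpow: "walk_betw E u v p \<Longrightarrow> (u, v) \<in> E ^^ (length p - 1)"
proof (induction p arbitrary: u)
  case (Cons x p)
  then show ?case
  proof (cases "p = []")
    case False
    then have "(x, hd p) \<in> E" "(hd p, v) \<in> E ^^ (length p - 1)"
      using Cons by (auto simp: walk_betw_def successively_Cons)
    then have "(x, v) \<in> E ^^ Suc (length p - 1)" by (rule relpow_Suc_I2)
    then show ?thesis using False Cons.prems by (simp add: walk_betw_def Suc_diff_1 del: relpow.simps)
  qed (auto simp: walk_betw_def)
qed (simp add: walk_betw_def)

text \<open>Cutting out the stretch between two occurrences of a node would give a walk shorter than
  the distance.\<close>

lemma walk_betw_distinct:
  assumes p: "walk_betw E u v p" and "length p = Suc (graph_dist E u v)"
  shows "distinct p"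
proof (rule ccontr)
  assume "\<not> distinct p"
  then obtain xs ys zs y where d: "p = xs @ [y] @ ys @ [y] @ zs" by (meson not_distinct_decomp)
  with p have "walk_betw E u v (xs @ [y] @ zs)"
    by (cases xs; cases zs) (auto simp: walk_betw_def successively_append_iff successively_Cons hd_append)
  from graph_dist_le[OF walk_betw_relpow[OF this]] show False using assms(2) d by simp
qed

lemma vwalk_iff_successively:
  "vwalk p (with_proj G) \<longleftrightarrow>
     p \<noteq> [] \<and> set p \<subseteq> pverts G \<and> successively (\<lambda>x y. (x, y) \<in> parcs G) p"
proof -
  have "set (vwalk_arcs p) \<subseteq> E \<longleftrightarrow> successively (\<lambda>x y. (x, y) \<in> E) p" for E :: "('a \<times> 'a) set"
    by (induction p rule: vwalk_arcs.induct) auto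
  then show ?thesis by (auto simp: vwalk_def)
qed

lemma walk_betw_verts:
  assumes "E \<subseteq> V \<times> V" and "u \<in> V" and "walk_betw E u v p"
  shows "set p \<subseteq> V"
  using assms(2,3)
proof (induction p arbitrary: u)
  case (Cons x p)
  show ?case
  proof (cases "p = []")
    case False
    then have "(x, hd p) \<in> E" "walk_betw E (hd p) v p"
      using Cons by (auto simp: walk_betw_def successively_Cons)
    then show ?thesis using Cons assms(1) by (auto simp: walk_betw_def)
  qed (use Cons in \<open>auto simp: walk_betw_def\<close>)
qed simp

text \<open>List lengths count nodes and \<open>graph_dist\<close> counts arcs, hence the
  \<open>Suc\<close>. A walk attaining the distance repeats no node and so is a path.\<close>

lemma shortest_pathI:
  assumes "pair_wf_digraph G" and "s \<in> pverts G"
    and p: "walk_betw (parcs G) s t p" and len: "length p \<le> Suc (graph_dist (parcs G) s t)"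
  shows "shortest_path G s t p"
proof -
  interpret pair_wf_digraph G by fact
  have sub: "parcs G \<subseteq> pverts G \<times> pverts G" using arc_fst_in_verts arc_snd_in_verts by fastforce
  have "length p = Suc (graph_dist (parcs G) s t)"
    using graph_dist_le[OF walk_betw_relpow[OF p]] len p by (cases p) (auto simp: walk_betw_def)
  moreover have "graph_dist (parcs G) s t \<le> length q - 1"
    if "vwalk q (with_proj G)" "hd q = s" "last q = t" for q
    using that by (intro graph_dist_le walk_betw_relpow) (auto simp: walk_betw_def vwalk_iff_successively)
  ultimately show ?thesis
    using p walk_betw_verts[OF sub assms(2) p] walk_betw_distinct[OF p]
    by (auto simp: shortest_path_def vpath_def vwalk_iff_successively walk_betw_def)
qed

section \<open>Runs of bidirectional BFS\<close>

text \<open>The tree of \<open>r\<close> when \<open>m\<close> layers beyond the root are complete.\<close>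

definition bfs_inv :: "'a pair_pre_digraph \<Rightarrow> 'a \<Rightarrow> nat \<Rightarrow> 'a bfs_tree \<Rightarrow> bool" where
  "bfs_inv G r m T \<longleftrightarrow>
     layer T = graph_sphere (parcs G) r m \<and>
     visited T = graph_ball (parcs G) r m \<union> next_layer T \<and>
     next_layer T \<subseteq> graph_sphere (parcs G) r (Suc m) \<and>
     (\<forall>v\<in>visited T. walk_betw (parcs G) r v (root_path T v) \<and>
        length (root_path T v) = Suc (graph_dist (parcs G) r v))"

lemma bfs_inv_root: "bfs_inv G r 0 (bfs_root r)"
  by (simp add: bfs_inv_def bfs_root_def graph_ball_0 graph_sphere_0 walk_betw_singleton graph_dist_sphere[of r _ r 0])

text \<open>An unvisited neighbour of layer \<open>m\<close> is outside the ball of radius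
  \<open>m\<close>, hence at distance exactly \<open>m + 1\<close>, whichever parent is
  chosen.\<close>

lemma bfs_inv_discover:
  assumes inv: "bfs_inv G r m T" and "bfs_discover G T T'"
  obtains w where "w \<notin> visited T" "visited T' = insert w (visited T)"
    "w \<in> graph_sphere (parcs G) r (Suc m)" "bfs_inv G r m T'"
  using assms(2)
proof cases
  case (1 u w)
  have w: "w \<in> graph_sphere (parcs G) r (Suc m)"
    using 1 inv by (auto simp: graph_sphere_Suc_conv bfs_inv_def)
  have u: "u \<in> visited T" "u \<in> graph_sphere (parcs G) r m"
    using 1 inv by (auto simp: bfs_inv_def graph_sphere_def graph_ball_def)
  have "walk_betw (parcs G) r w (root_path T u @ [w])"
    using inv u 1 by (auto simp: bfs_inv_def intro: walk_betw_snoc)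
  moreover have "length (root_path T u @ [w]) = Suc (graph_dist (parcs G) r w)"
    using inv u by (simp add: bfs_inv_def graph_dist_sphere[OF u(2)] graph_dist_sphere[OF w])
  ultimately have "bfs_inv G r m T'" using inv w 1 by (auto simp: bfs_inv_def)
  then show ?thesis using 1 w by (intro that[of w]) auto
qed

lemma bfs_inv_advance:
  assumes inv: "bfs_inv G r m T" and "next_layer_complete G T"
  shows "bfs_inv G r (Suc m) (advance_layer T)"
proof -
  have "graph_sphere (parcs G) r (Suc m) \<subseteq> next_layer T"
  proof
    fix v assume v: "v \<in> graph_sphere (parcs G) r (Suc m)"
    then obtain u where "u \<in> layer T" "(u, v) \<in> parcs G"
      using inv by (auto simp: graph_sphere_Suc_conv bfs_inv_def)
    then have "v \<in> visited T" using assms(2) by (auto simp: next_layer_complete_def)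
    with v inv show "v \<in> next_layer T" by (auto simp: bfs_inv_def graph_sphere_Suc_conv)
  qed
  with inv have "next_layer T = graph_sphere (parcs G) r (Suc m)" by (auto simp: bfs_inv_def)
  with inv show ?thesis by (simp add: bfs_inv_def advance_layer_def graph_ball_Suc)
qed

text \<open>The tree of \<open>s\<close> is one layer ahead during \<open>Grow_t\<close>. The
  waiting tree has an empty next layer, hence is exactly a ball, and \<open>Suc D div 2\<close> is
  half the distance rounded up. The last conjunct places common nodes on shortest walks.\<close>

fun bibfs_inv :: "'a pair_pre_digraph \<Rightarrow> 'a \<Rightarrow> 'a \<Rightarrow> nat \<Rightarrow> nat \<Rightarrow> 'a bibfs_state \<Rightarrow> bool" where
  "bibfs_inv G s t a b (c, S, T) \<longleftrightarrow>
     bfs_inv G s a S \<and> bfs_inv G t b T \<and>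
     (case c of Grow_s \<Rightarrow> a = b \<and> next_layer T = {} | Grow_t \<Rightarrow> a = Suc b \<and> next_layer S = {}) \<and>
     (let D = graph_dist (parcs G) s t in
       visited S \<subseteq> graph_ball (parcs G) s (Suc D div 2) \<and>
       visited T \<subseteq> graph_ball (parcs G) t (Suc D div 2) \<and>
       (\<forall>v\<in>visited S \<inter> visited T. graph_dist (parcs G) s v + graph_dist (parcs G) t v \<le> D))"

text \<open>Advancing visits no node, so completed layers are counted as well; every step then adds
  exactly one.\<close>

fun bibfs_progress :: "nat \<Rightarrow> nat \<Rightarrow> 'a bibfs_state \<Rightarrow> nat" where
  "bibfs_progress a b (c, S, T) = a + b + card (visited S) + card (visited T)"

lemma bibfs_inv_start: "bibfs_inv G s t 0 0 (bibfs_start s t)"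
proof -
  have "r \<in> graph_ball E r m" for r :: 'a and E m
    by (auto simp: graph_ball_def intro!: exI[of _ 0])
  moreover have "graph_dist E r r = 0" for r :: 'a and E
    by (rule graph_dist_sphere) (simp add: graph_sphere_0)
  ultimately show ?thesis
    by (simp add: bibfs_start_def bfs_inv_root) (auto simp: bfs_root_def Let_def)
qed

text \<open>Steps happen only while the trees are disjoint, which forces \<open>a + b < D\<close>
  for the distance \<open>D\<close>. A discovery is one layer further out, so a node it makes common
  has distances summing to at most \<open>a + b + 1 <= D\<close>.\<close>

lemma bibfs_inv_step:
  assumes E: "sym (parcs G)" "finite (parcs G)" and st: "(s, t) \<in> (parcs G)\<^sup>*"
    and inv: "bibfs_inv G s t a b \<sigma>" and step: "bibfs_step G \<sigma> \<sigma>'"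
  shows "\<exists>a' b'. bibfs_inv G s t a' b' \<sigma>' \<and> bibfs_progress a' b' \<sigma>' = Suc (bibfs_progress a b \<sigma>)
    \<and> a + b < graph_dist (parcs G) s t"
proof -
  let ?E = "parcs G"
  define D where "D = graph_dist ?E s t"
  have D: "(s, t) \<in> ?E ^^ D" using st graph_dist_relpow unfolding D_def by (metis rtrancl_power)
  have lt: "a + b < D" if "bfs_inv G s a S" "bfs_inv G t b T" "visited S \<inter> visited T = {}" for S T
    using that by (intro disjoint_balls_dist[OF E(1) D]) (auto simp: bfs_inv_def)
  have fin: "finite (visited T)" if "bfs_inv G r m T" for r m T
  proof -
    have "visited T \<subseteq> graph_ball ?E r (Suc m)" using that by (auto simp: bfs_inv_def graph_ball_Suc)
    then show ?thesis using finite_graph_ball[OF E(2)] by (rule finite_subset)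
  qed
  have sphere_ball: "w \<in> graph_ball ?E r l" if "w \<in> graph_sphere ?E r m" "m \<le> l" for w r m l
    using that by (auto simp: graph_sphere_def graph_ball_def)
  from step show ?thesis
  proof cases
    case (1 S T S')
    from 1 inv have I: "bfs_inv G s a S" "bfs_inv G t b T" "a = b" "next_layer T = {}" by auto
    from bfs_inv_discover[OF I(1) 1(4)] obtain w where w: "w \<notin> visited S" "visited S' = insert w (visited S)"
      "w \<in> graph_sphere ?E s (Suc a)" "bfs_inv G s a S'" by metis
    have "a + b < D" using lt I 1 by blast
    moreover have "graph_dist ?E s w + graph_dist ?E t w \<le> D" if "w \<in> visited T"
      using graph_dist_sphere[OF w(3)] graph_dist_ball[of w ?E t b] that I \<open>a + b < D\<close>
      by (auto simp: bfs_inv_def)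
    \<comment> \<open>From \<open>a = b\<close> and \<open>2 * a + 1 <= D\<close> follows
      \<open>Suc a <= Suc D div 2\<close>.\<close>
    moreover have "w \<in> graph_ball ?E s (Suc D div 2)"
      using \<open>a + b < D\<close> \<open>a = b\<close> by (intro sphere_ball[OF w(3)]) auto
    ultimately have "bibfs_inv G s t a b \<sigma>'" "bibfs_progress a b \<sigma>' = Suc (bibfs_progress a b \<sigma>)"
      using 1 inv w I fin[OF I(1)] by (auto simp: D_def Let_def)
    then show ?thesis using \<open>a + b < D\<close> unfolding D_def by blast
  next
    case (2 S T)
    from 2 inv have I: "bfs_inv G s a S" "bfs_inv G t b T" "a = b" "next_layer T = {}" by auto
    have "a + b < D" using lt I 2 by blast
    moreover have "bibfs_inv G s t (Suc a) b \<sigma>'" "bibfs_progress (Suc a) b \<sigma>' = Suc (bibfs_progress a b \<sigma>)"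
      using 2 inv bfs_inv_advance[OF I(1) 2(4)] by (auto simp: Let_def) (auto simp: advance_layer_def)
    ultimately show ?thesis unfolding D_def by blast
  next
    case (3 S T T')
    from 3 inv have I: "bfs_inv G s a S" "bfs_inv G t b T" "a = Suc b" "next_layer S = {}" by auto
    from bfs_inv_discover[OF I(2) 3(4)] obtain w where w: "w \<notin> visited T" "visited T' = insert w (visited T)"
      "w \<in> graph_sphere ?E t (Suc b)" "bfs_inv G t b T'" by metis
    have "a + b < D" using lt I 3 by blast
    moreover have "graph_dist ?E s w + graph_dist ?E t w \<le> D" if "w \<in> visited S"
      using graph_dist_sphere[OF w(3)] graph_dist_ball[of w ?E s a] that I \<open>a + b < D\<close>
      by (auto simp: bfs_inv_def)
    moreover have "w \<in> graph_ball ?E t (Suc D div 2)"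
      using \<open>a + b < D\<close> \<open>a = Suc b\<close> by (intro sphere_ball[OF w(3)]) auto
    ultimately have "bibfs_inv G s t a b \<sigma>'" "bibfs_progress a b \<sigma>' = Suc (bibfs_progress a b \<sigma>)"
      using 3 inv w I fin[OF I(2)] by (auto simp: D_def Let_def)
    then show ?thesis using \<open>a + b < D\<close> unfolding D_def by blast
  next
    case (4 S T)
    from 4 inv have I: "bfs_inv G s a S" "bfs_inv G t b T" "a = Suc b" "next_layer S = {}" by auto
    have "a + b < D" using lt I 4 by blast
    moreover have "bibfs_inv G s t a (Suc b) \<sigma>'" "bibfs_progress a (Suc b) \<sigma>' = Suc (bibfs_progress a b \<sigma>)"
      using 4 inv bfs_inv_advance[OF I(2) 4(4)] by (auto simp: Let_def) (auto simp: advance_layer_def)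
    ultimately show ?thesis unfolding D_def by blast
  qed
qed

text \<open>After \<open>i\<close> steps the progress is at least \<open>i\<close>, yet it is
  bounded: layers by the distance, visited nodes by two fixed balls.\<close>

lemma bibfs_terminatesI:
  assumes E: "sym (parcs G)" "finite (parcs G)" and st: "(s, t) \<in> (parcs G)\<^sup>*"
  shows "bibfs_terminates G s t"
  unfolding bibfs_terminates_def
proof
  assume "\<exists>\<sigma>. \<sigma> 0 = bibfs_start s t \<and> (\<forall>i. bibfs_step G (\<sigma> i) (\<sigma> (Suc i)))"
  then obtain \<sigma> where \<sigma>: "\<sigma> 0 = bibfs_start s t" "\<And>i. bibfs_step G (\<sigma> i) (\<sigma> (Suc i))" by blast
  let ?D = "graph_dist (parcs G) s t"
  define N where "N r = card (graph_ball (parcs G) r (Suc ?D div 2))" for r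
  have inv: "\<exists>a b. bibfs_inv G s t a b (\<sigma> i) \<and> i \<le> bibfs_progress a b (\<sigma> i)" for i
  proof (induction i)
    case 0
    then show ?case using bibfs_inv_start \<sigma>(1) by (metis le0)
  next
    case (Suc i)
    then show ?case using bibfs_inv_step[OF assms _ \<sigma>(2)] by (metis Suc_le_mono)
  qed
  have "i < ?D + N s + N t" for i
  proof -
    obtain a b where ab: "bibfs_inv G s t a b (\<sigma> i)" "i \<le> bibfs_progress a b (\<sigma> i)" using inv by blast
    obtain c S T where cST: "\<sigma> i = (c, S, T)" by (metis prod_cases3)
    have "card (visited S) \<le> N s" "card (visited T) \<le> N t"
      using ab(1) finite_graph_ball[OF E(2)] unfolding N_def cST by (auto simp: Let_def intro: card_mono)
    moreover have "a + b < ?D" using bibfs_inv_step[OF assms ab(1) \<sigma>(2)] by blast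
    ultimately show ?thesis using ab(2) cST by simp
  qed
  then show False by blast
qed

text \<open>With disjoint trees either a node can be discovered or the layer is complete, so a run
  can only get stuck at a common node.\<close>

lemma bibfs_result_inv:
  assumes E: "sym (parcs G)" "finite (parcs G)" and st: "(s, t) \<in> (parcs G)\<^sup>*"
    and res: "bibfs_result G s t S T"
  shows "visited S \<inter> visited T \<noteq> {} \<and> (\<exists>a b c. bibfs_inv G s t a b (c, S, T))"
proof -
  obtain c where run: "(bibfs_step G)\<^sup>*\<^sup>* (bibfs_start s t) (c, S, T)"
    and stuck: "\<not> (\<exists>\<sigma>. bibfs_step G (c, S, T) \<sigma>)"
    using res by (auto simp: bibfs_result_def)
  have "\<exists>a b. bibfs_inv G s t a b (c, S, T)" using run
  proof (induction rule: rtranclp_induct)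
    case base
    show ?case by (intro exI) (rule bibfs_inv_start)
  next
    case (step \<sigma> \<sigma>')
    then show ?case using bibfs_inv_step[OF E st] by blast
  qed
  moreover have "visited S \<inter> visited T \<noteq> {}"
  proof
    assume disj: "visited S \<inter> visited T = {}"
    have grow: "next_layer_complete G X \<or> (\<exists>X'. bfs_discover G X X')" for X
      unfolding next_layer_complete_def by (meson bfs_discover.intros)
    show False
    proof (cases c)
      case Grow_s
      then show ?thesis using disj grow[of S] stuck by (blast intro: bibfs_step.intros)
    next
      case Grow_t
      then show ?thesis using disj grow[of T] stuck by (blast intro: bibfs_step.intros)
    qed
  qed
  ultimately show ?thesis by blast
qed

text \<open>The two tree paths share the common node, so the joined list has at most distance plus
  one nodes. Each tree may use half of the budget \<open>b\<close>.\<close>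

lemma bibfs_finds_shortest_pathI:
  assumes G: "pair_graph G" and s: "s \<in> pverts G" and st: "(s, t) \<in> (parcs G)\<^sup>*"
    and bound: "\<And>r. real (card (graph_ball (parcs G) r (Suc (graph_dist (parcs G) s t) div 2))) \<le> b / 2"
  shows "bibfs_finds_shortest_path G s t b"
proof -
  interpret pair_graph G by fact
  have E: "sym (parcs G)" "finite (parcs G)"
    using sym_arcs pair_finite_arcs by (auto simp: symmetric_def)
  have "shortest_path G s t (vwalk_join (root_path S v) (rev (root_path T v)))"
    if "bibfs_result G s t S T" "v \<in> visited S \<inter> visited T" for S T v
  proof -
    from bibfs_result_inv[OF E st that(1)] obtain a b c where inv: "bibfs_inv G s t a b (c, S, T)"
      by blast
    have p: "walk_betw (parcs G) s v (root_path S v)" "walk_betw (parcs G) t v (root_path T v)"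
      "length (root_path S v) = Suc (graph_dist (parcs G) s v)"
      "length (root_path T v) = Suc (graph_dist (parcs G) t v)"
      "graph_dist (parcs G) s v + graph_dist (parcs G) t v \<le> graph_dist (parcs G) s t"
      using inv that(2) by (auto simp: bfs_inv_def Let_def)
    show ?thesis unfolding vwalk_join_def
      using p walk_betw_join[OF p(1) walk_betw_rev[OF E(1) p(2)]]
      by (intro shortest_pathI[OF _ s]) (auto intro: pair_wf_digraph)
  qed
  moreover have "real (card (visited S) + card (visited T)) \<le> b" if "bibfs_result G s t S T" for S T
  proof -
    let ?r = "Suc (graph_dist (parcs G) s t) div 2"
    have "visited S \<subseteq> graph_ball (parcs G) s ?r" "visited T \<subseteq> graph_ball (parcs G) t ?r"
      using bibfs_result_inv[OF E st that] by (auto simp: Let_def)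
    then have "card (visited S) \<le> card (graph_ball (parcs G) s ?r)"
      "card (visited T) \<le> card (graph_ball (parcs G) t ?r)"
      using finite_graph_ball[OF E(2)] by (auto intro: card_mono)
    then show ?thesis using bound[of s] bound[of t] by linarith
  qed
  ultimately show ?thesis
    unfolding bibfs_finds_shortest_path_def
    using bibfs_terminatesI[OF E st] bibfs_result_inv[OF E st] by blast
qed

text \<open>The nodes within distance \<open>k\<close> of \<open>s\<close> are good targets: both
  trees then stay in balls of radius \<open>k / 2\<close> rounded up, each with at most
  \<open>2 * d * (d - 1) ^ (Suc k div 2)\<close> nodes.\<close>

lemma ramanujan_card_bibfs_ge:
  assumes G: "ramanujan_graph n d G" and d: "d \<ge> 3" and s: "s \<in> pverts G"
  shows "real (card {t \<in> pverts G. bibfs_finds_shortest_path G s t (4 * real d * (real d - 1) ^ (Suc k div 2))})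
    \<ge> real n - (real n * (real k + 1))\<^sup>2 / (real d - 1) ^ k"
proof -
  interpret pair_graph G using G by (simp add: ramanujan_graph_def)
  have V: "pverts G = {..<n}" using G by (simp add: ramanujan_graph_def)
  have E: "sym (parcs G)" "finite (parcs G)"
    using sym_arcs pair_finite_arcs by (auto simp: symmetric_def)
  have deg: "card (parcs G `` {v}) \<le> d" for v
  proof (cases "v < n")
    case False
    then have "parcs G `` {v} = {}" using arc_fst_in_verts V by fastforce
    then show ?thesis by simp
  qed (simp add: ramanujan_card_neighbours[OF G])
  let ?B = "graph_ball (parcs G) s k"
  let ?f = "4 * real d * (real d - 1) ^ (Suc k div 2)"
  have "bibfs_finds_shortest_path G s t ?f" if "t \<in> ?B" for t
  proof (rule bibfs_finds_shortest_pathI[OF _ s])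
    show "(s, t) \<in> (parcs G)\<^sup>*" using that by (auto simp: graph_ball_def intro: relpow_imp_rtrancl)
    fix r
    let ?m = "Suc (graph_dist (parcs G) s t) div 2"
    have "?m \<le> Suc k div 2" using graph_dist_ball[OF that] by (intro div_le_mono) simp
    then have "card (graph_ball (parcs G) r ?m) \<le> card (graph_ball (parcs G) r (Suc k div 2))"
      by (intro card_mono finite_graph_ball E graph_ball_mono)
    also have "\<dots> \<le> 2 * d * (d - 1) ^ (Suc k div 2)" by (rule card_graph_ball_le[OF E(2,1) deg d])
    finally have "real (card (graph_ball (parcs G) r ?m)) \<le> real (2 * d * (d - 1) ^ (Suc k div 2))"
      by (rule of_nat_mono)
    also have "\<dots> = ?f / 2" using d by (simp add: of_nat_diff)
    finally show "real (card (graph_ball (parcs G) r ?m)) \<le> ?f / 2" .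
  qed unfold_locales
  then have "card ({..<n} \<inter> ?B) \<le> card {t \<in> pverts G. bibfs_finds_shortest_path G s t ?f}"
    unfolding V by (intro card_mono) auto
  moreover have "card ({..<n} \<inter> ?B) + card ({..<n} - ?B) = n"
    by (subst card_Un_disjoint[symmetric]) (auto simp: Int_Diff_Un)
  moreover have "real (card ({..<n} - ?B)) \<le> (real n * (real k + 1))\<^sup>2 / (real d - 1) ^ k"
    using s V by (intro ramanujan_card_outside_ball[OF G d]) auto
  ultimately show ?thesis by linarith
qed

section \<open>Choice of the radius\<close>

text \<open>The exponent 3 serves two bounds. As \<open>k\<close> is at most of order
  \<open>ln n\<close>, the far fraction \<open>n (k + 1)^2 / q^k\<close> is at most of order
  \<open>1 / ln n\<close>, while \<open>q^(k/2)\<close> stays of order \<open>sqrt n\<close> times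
  \<open>(ln n)^(3/2)\<close>.\<close>

definition search_radius :: "real \<Rightarrow> nat \<Rightarrow> nat" where
  "search_radius q n = (LEAST k. q ^ k \<ge> real n * ln (real n) ^ 3)"

lemma search_radius_ge:
  assumes "q > 1"
  shows "q ^ search_radius q n \<ge> real n * ln (real n) ^ 3"
proof -
  obtain k where "real n * ln (real n) ^ 3 < q ^ k" using real_arch_pow[OF assms] by blast
  then show ?thesis
    using LeastI[of "\<lambda>k. real n * ln (real n) ^ 3 \<le> q ^ k" k] by (simp add: search_radius_def)
qed

lemma ln_real_ge_1: "n \<ge> 3 \<Longrightarrow> ln (real n) \<ge> 1"
  using exp_le by (subst ln_ge_iff) auto

lemma search_radius_bounds:
  assumes q: "q > 1" and n: "n \<ge> 3"
  shows "search_radius q n > 0" and "q ^ search_radius q n < q * (real n * ln (real n) ^ 3)"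
proof -
  \<comment> \<open>The threshold exceeds \<open>q ^ 0\<close>, which rules out radius 0 and makes
    the radius minus one a genuine predecessor.\<close>
  have "1 < real n * ln (real n) ^ 3"
    using n ln_real_ge_1[OF n] by (intro less_1_mult'[of "real n"]) auto
  then show pos: "search_radius q n > 0"
    using search_radius_ge[OF q, of n] by (cases "search_radius q n = 0") auto
  then have "\<not> real n * ln (real n) ^ 3 \<le> q ^ (search_radius q n - 1)"
    unfolding search_radius_def by (intro not_less_Least) auto
  then have "q * q ^ (search_radius q n - 1) < q * (real n * ln (real n) ^ 3)" using q by simp
  then show "q ^ search_radius q n < q * (real n * ln (real n) ^ 3)"
    using pos by (simp flip: power_Suc)
qed

lemma search_radius_le_ln:
  assumes q: "q \<ge> 2" and n: "n \<ge> 3"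
  shows "real (search_radius q n) + 1 \<le> 10 * ln (real n)"
proof -
  let ?k = "search_radius q n" and ?L = "ln (real n)"
  have L: "?L \<ge> 1" by (rule ln_real_ge_1[OF n])
  have pos: "?k > 0" using q n by (intro search_radius_bounds) auto
  have "q * q ^ (?k - 1) < q * (real n * ?L ^ 3)"
    using search_radius_bounds(2)[OF _ n, of q] q pos by (simp flip: power_Suc)
  then have "2 ^ (?k - 1) \<le> real n * ?L ^ 3"
    using q power_mono[of 2 q "?k - 1"] by simp
  also have "\<dots> \<le> real n * real n ^ 3"
    using L n ln_le_minus_one[of "real n"] by (intro mult_left_mono power_mono) auto
  finally have "(2 :: real) ^ (?k - 1) \<le> real n ^ 4" by (simp add: power_numeral_reduce)
  then have "ln ((2 :: real) ^ (?k - 1)) \<le> ln (real n ^ 4)" using n by (subst ln_le_cancel_iff) auto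
  then have "real (?k - 1) * ln 2 \<le> 4 * ?L" using n by (simp add: ln_realpow)
  \<comment> \<open>The bound \<open>ln 2 >= 1 / 2\<close> comes from \<open>ln 4 >= 1\<close>.
    Hence \<open>k - 1 <= 8 * ln n\<close>, and \<open>ln n >= 1\<close> absorbs the remaining 2
    into the factor 10.\<close>
  moreover have "real (?k - 1) * (1 / 2) \<le> real (?k - 1) * ln 2"
    using ln_real_ge_1[of 4] ln_realpow[of 2 2] by (intro mult_left_mono) auto
  ultimately show ?thesis using L pos by (simp add: of_nat_diff)
qed

text \<open>Compared after squaring: rounding the half exponent up costs one factor
  \<open>q\<close>, minimality of the radius another, which leaves \<open>q\<close> after taking the
  root.\<close>

lemma search_radius_visited_bigo:
  assumes q: "q > 1"
  shows "(\<lambda>n. c * q ^ (Suc (search_radius q n) div 2))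
    \<in> O(\<lambda>n. sqrt (real n) * ln (real n) powr (3 / 2))"
proof (rule bigoI)
  show "\<forall>\<^sub>F n in sequentially. norm (c * q ^ (Suc (search_radius q n) div 2))
      \<le> (\<bar>c\<bar> * q) * norm (sqrt (real n) * ln (real n) powr (3 / 2))"
    using eventually_ge_at_top[of 3]
  proof eventually_elim
    case (elim n)
    let ?k = "search_radius q n" and ?L = "ln (real n)"
    have L: "?L \<ge> 1" by (rule ln_real_ge_1[OF elim])
    have "(?L powr (3 / 2))\<^sup>2 = ?L powr (3 / 2 + 3 / 2)" by (simp only: power2_eq_square powr_add)
    also have "\<dots> = ?L ^ 3" using L powr_realpow[of ?L 3] by simp
    finally have powr_sq: "(?L powr (3 / 2))\<^sup>2 = ?L ^ 3" .
    have sq: "(q * (sqrt (real n) * ?L powr (3 / 2)))\<^sup>2 = q * (q * (real n * ?L ^ 3))"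
      unfolding power_mult_distrib powr_sq by (simp add: power2_eq_square[of q])
    have "(q ^ (Suc ?k div 2))\<^sup>2 = q ^ (2 * (Suc ?k div 2))" by (simp add: power_mult[symmetric] mult.commute)
    also have "\<dots> \<le> q ^ Suc ?k" using q by (intro power_increasing) auto
    also have "\<dots> \<le> q * (q * (real n * ?L ^ 3))"
      using search_radius_bounds(2)[OF q elim] q by simp
    finally have "(q ^ (Suc ?k div 2))\<^sup>2 \<le> (q * (sqrt (real n) * ?L powr (3 / 2)))\<^sup>2" unfolding sq .
    then have "q ^ (Suc ?k div 2) \<le> q * (sqrt (real n) * ?L powr (3 / 2))"
      by (rule power2_le_imp_le) (use q in simp)
    then have "\<bar>c\<bar> * q ^ (Suc ?k div 2) \<le> \<bar>c\<bar> * (q * (sqrt (real n) * ?L powr (3 / 2)))"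
      by (rule mult_left_mono) simp
    then show ?case using q by (simp add: abs_mult mult.assoc)
  qed
qed

lemma search_radius_error_smallo:
  assumes q: "q \<ge> 2"
  shows "(\<lambda>n. real n * (real (search_radius q n) + 1)\<^sup>2 / q ^ search_radius q n) \<in> o(\<lambda>_. 1)"
proof (rule smalloI_tendsto)
  let ?\<epsilon> = "\<lambda>n. real n * (real (search_radius q n) + 1)\<^sup>2 / q ^ search_radius q n"
  have lim: "(\<lambda>n. 100 / ln (real n)) \<longlonglongrightarrow> 0"
    by (intro tendsto_divide_0[OF tendsto_const] filterlim_at_top_imp_at_infinity
        filterlim_compose[OF ln_at_top] filterlim_real_sequentially)
  have upper: "\<forall>\<^sub>F n in sequentially. ?\<epsilon> n \<le> 100 / ln (real n)"
    using eventually_ge_at_top[of 3]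
  proof eventually_elim
    case (elim n)
    let ?k = "search_radius q n" and ?L = "ln (real n)"
    have L: "?L \<ge> 1" by (rule ln_real_ge_1[OF elim])
    have "?\<epsilon> n \<le> real n * (10 * ?L)\<^sup>2 / (real n * ?L ^ 3)"
      using search_radius_le_ln[OF q elim] search_radius_ge[of q n] q L elim
      by (intro frac_le mult_left_mono power_mono) auto
    also have "\<dots> = 100 / ?L" using L elim by (simp add: power2_eq_square power3_eq_cube)
    finally show ?case .
  qed
  have lower: "\<forall>\<^sub>F n in sequentially. 0 \<le> ?\<epsilon> n" using q by simp
  have "?\<epsilon> \<longlonglongrightarrow> 0" by (rule tendsto_sandwich[OF lower upper tendsto_const lim])
  then show "(\<lambda>n. ?\<epsilon> n / 1) \<longlonglongrightarrow> 0" by simp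
qed simp

theorem theorem2:
  fixes d :: nat
  assumes "d \<ge> 3"
  shows "\<exists>(f :: nat \<Rightarrow> real) (\<epsilon> :: nat \<Rightarrow> real).
    f \<in> O(\<lambda>n. sqrt (real n) * ln (real n) powr (3 / 2)) \<and> \<epsilon> \<in> o(\<lambda>_. 1) \<and>
    (\<forall>n G s. ramanujan_graph n d G \<and> s \<in> pverts G \<longrightarrow>
       real (card {t \<in> pverts G. bibfs_finds_shortest_path G s t (f n)}) \<ge> (1 - \<epsilon> n) * real n)"
proof (intro exI conjI allI impI)
  let ?q = "real d - 1"
  let ?k = "search_radius ?q"
  \<comment> \<open>The bound on the number of far nodes divided by \<open>n\<close>. Radius and
    error depend on \<open>d\<close> and \<open>n\<close> only, which makes the estimate uniform in
    \<open>G\<close> and \<open>s\<close>.\<close>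
  let ?\<epsilon> = "\<lambda>n. real n * (real (?k n) + 1)\<^sup>2 / ?q ^ ?k n"
  show "(\<lambda>n. 4 * real d * ?q ^ (Suc (?k n) div 2)) \<in> O(\<lambda>n. sqrt (real n) * ln (real n) powr (3 / 2))"
    using assms by (intro search_radius_visited_bigo) simp
  show "?\<epsilon> \<in> o(\<lambda>_. 1)"
    using assms by (intro search_radius_error_smallo) simp
  fix n G s
  assume "ramanujan_graph n d G \<and> s \<in> pverts G"
  then have "real n - (real n * (real (?k n) + 1))\<^sup>2 / ?q ^ ?k n
      \<le> real (card {t \<in> pverts G. bibfs_finds_shortest_path G s t (4 * real d * ?q ^ (Suc (?k n) div 2))})"
    using ramanujan_card_bibfs_ge[OF _ assms, of n G s "?k n"] by simp
  moreover have "(1 - ?\<epsilon> n) * real n = real n - (real n * (real (?k n) + 1))\<^sup>2 / ?q ^ ?k n"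
    by (simp add: power2_eq_square algebra_simps)
  ultimately show "(1 - ?\<epsilon> n) * real n
      \<le> real (card {t \<in> pverts G. bibfs_finds_shortest_path G s t (4 * real d * ?q ^ (Suc (?k n) div 2))})"
    by simp
qed

end
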